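(* Let $\mathbf A\in L(\mathbb R^n)$ be an orthogonal operator, let $X_0\in\operatorname{conv}\mathbb R^n$ with $\operatorname{int}X_0\ne\emptyset$, and let $X(t)$, $t\ge0$, be the solution of $D_HX(t)=\mathbf AX(t)$, $X(0)=X_0$. Then for all $t\ge0$ $$V[X_0]\,e^{nt}\le V[X(t)]\le M[X_0]\,e^{nt},$$ where $$M[X_0]=\sup_{k_1,\dots,k_{n-1}\ge0}V[\mathbf A^{k_1}X_0,\mathbf A^{k_2}X_0,\dots,\mathbf A^{k_{n-1}}X_0,X_0],$$ the supremum being over all $(n-1)$-tuples of nonnegative integers.
   Context: $\operatorname{conv}\mathbb R^n$ is the space of nonempty convex compact subsets of $\mathbb R^n$ with the Hausdorff metric $d_H$. $\mathbf AX=\{\mathbf Ax:x\in X\}$; sums of sets are Minkowski sums. $V[X]$ is the volume and $V[X_1,\dots,X_n]$ the mixed volume, normalized so that $V[X,\dots,X]=V[X]$. Hukuhara derivative: for $X,Y\in\operatorname{conv}\mathbb R^n$, the Hukuhara difference $X\ominus Y$ is the set $Z\in\operatorname{conv}\mathbb R^n$ with $X=Y+Z$, if it exists. $D_HX(t)$ is the element of $\operatorname{conv}\mathbb R^n$ that is the common $d_H$-limit, as $h\to0^+$, of $h^{-1}(X(t+h)\ominus X(t))$ and $h^{-1}(X(t)\ominus X(t-h))$ (only the first at $t=0$). The Cauchy problem $D_HX=\mathbf AX$, $X(0)=X_0$, has a unique solution on $[0,\infty)$, equivalently $X(t)=X_0+\int_0^t\mathbf AX(s)\,ds$ (set-valued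 integral). *)

theory Defs
  imports "HOL-Analysis.Analysis"
begin

(* Throughout, + and \<Sum> on sets are the Minkowski operations of HOL-Library.Set_Algebras. *)

definition conv_bodies :: "'a::euclidean_space set set" where
  "conv_bodies = {K. K \<noteq> {} \<and> convex K \<and> compact K}"

definition hausdorff_dist :: "'a::metric_space set \<Rightarrow> 'a set \<Rightarrow> real" where
  "hausdorff_dist X Y = max (SUP x\<in>X. infdist x Y) (SUP y\<in>Y. infdist y X)"

definition is_hukuhara_diff :: "'a::euclidean_space set \<Rightarrow> 'a set \<Rightarrow> 'a set \<Rightarrow> bool" where
  "is_hukuhara_diff X Y Z \<longleftrightarrow> Z \<in> conv_bodies \<and> X = Y + Z"

(* Meaningful for X and Y in conv_bodies when the difference exists; it is then unique by
   cancellation for compact convex sets. *)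
definition hukuhara_diff :: "'a::euclidean_space set \<Rightarrow> 'a set \<Rightarrow> 'a set" where
  "hukuhara_diff X Y = (THE Z. is_hukuhara_diff X Y Z)"

(* The derivative at t of a set-valued map on [0, \<infinity>). As hukuhara_diff is total, the existence of
   the differences for all small h > 0 has to be required explicitly. *)
definition has_hukuhara_derivative ::
    "(real \<Rightarrow> 'a::euclidean_space set) \<Rightarrow> 'a set \<Rightarrow> real \<Rightarrow> bool" where
  "has_hukuhara_derivative X D t \<longleftrightarrow>
     D \<in> conv_bodies \<and>
     (\<forall>\<^sub>F h in at_right 0. \<exists>Z. is_hukuhara_diff (X (t + h)) (X t) Z) \<and>
     ((\<lambda>h. hausdorff_dist ((*\<^sub>R) (inverse h) ` hukuhara_diff (X (t + h)) (X t)) D)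
        \<longlongrightarrow> 0) (at_right 0) \<and>
     (t > 0 \<longrightarrow>
        (\<forall>\<^sub>F h in at_right 0. \<exists>Z. is_hukuhara_diff (X t) (X (t - h)) Z) \<and>
        ((\<lambda>h. hausdorff_dist ((*\<^sub>R) (inverse h) ` hukuhara_diff (X t) (X (t - h))) D)
           \<longlongrightarrow> 0) (at_right 0))"

definition solves_hukuhara_cauchy ::
    "('a::euclidean_space \<Rightarrow> 'a) \<Rightarrow> 'a set \<Rightarrow> (real \<Rightarrow> 'a set) \<Rightarrow> bool" where
  "solves_hukuhara_cauchy A X0 X \<longleftrightarrow>
     X 0 = X0 \<and>
     (\<forall>t\<ge>0. X t \<in> conv_bodies \<and> has_hukuhara_derivative X (A ` X t) t)"

abbreviation volume :: "'a::euclidean_space set \<Rightarrow> real" where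
  "volume K \<equiv> measure lebesgue K"

(* c is a system of symmetric coefficients in Minkowski's expansion, with n = DIM('a),
     V[l_0 K_0 + ... + l_(m-1) K_(m-1)] = \<Sum> c [i_1, ..., i_n] * l_(i_1) * ... * l_(i_n)
   over all n-tuples of indices below m = length Ks, for all l_i \<ge> 0.
   Apart from symmetry, c is unconstrained on other lists. *)
definition minkowski_coeffs :: "'a::euclidean_space set list \<Rightarrow> (nat list \<Rightarrow> real) \<Rightarrow> bool" where
  "minkowski_coeffs Ks c \<longleftrightarrow>
     (\<forall>is js. mset is = mset js \<longrightarrow> c is = c js) \<and>
     (\<forall>l. (\<forall>i<length Ks. 0 \<le> l i) \<longrightarrow>
        volume (\<Sum>i<length Ks. (*\<^sub>R) (l i) ` (Ks ! i)) =
        (\<Sum>is | length is = DIM('a) \<and> set is \<subseteq> {..<length Ks}. c is * prod_list (map l is)))"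

(* The mixed volume V[K_1, ..., K_n] of a list of exactly n = DIM('a) sets in conv_bodies, i.e. the
   coefficient indexed by (1, ..., n) (here 0-based), which is determined by the expansion.
   Each product l_1 ... l_n arises from n! index tuples, so that V[K, ..., K] = V[K]. *)
definition mixed_volume :: "'a::euclidean_space set list \<Rightarrow> real" where
  "mixed_volume Ks = (THE v. \<exists>c. minkowski_coeffs Ks c \<and> v = c [0..<DIM('a)])"

(* The supremum of V[A^k_1 X0, ..., A^k_(n-1) X0, X0] over all (n-1)-tuples ks. The set of values is
   bounded for orthogonal A and X0 in conv_bodies, so the real supremum is the intended one. *)
definition orbit_mixed_volume_sup :: "('a::euclidean_space \<Rightarrow> 'a) \<Rightarrow> 'a set \<Rightarrow> real" where
  "orbit_mixed_volume_sup A X0 =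
     (SUP ks \<in> {ks :: nat list. length ks = DIM('a) - 1}.
        mixed_volume (map (\<lambda>k. (A ^^ k) ` X0) ks @ [X0]))"

end

(*
  Minkowski's expansion. For a finite set V the gradient of x |-> ln (\<Sum>v\<in>V. exp (v \<bullet> x)) takes
  values in the convex hull of V, and for nonnegative l_i the map G = \<Sum> l_i \<nabla>lse(V_i) is a
  diffeomorphism onto the interior of the polytope P = \<Sum> l_i conv V_i, up to the case that both
  P and det DG degenerate. Hence V[P] = \<integral> det (\<Sum> l_i H_i) with positive semidefinite Hessians H_i.
  Polarizing the determinant under the integral expresses the coefficients of this polynomial in l
  by volumes of partial sums of the polytopes; in this form the expansion survives the passage
  from polytopes to arbitrary convex bodies. It also identifies the mixed volume.

  The solution. Support functions satisfy h(t, u)' = h(t, A^{-1} u), so by Taylor's formula X(t) is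
  the Hausdorff limit of S_N = \<Sum>k\<le>N. (t^k / k!) A^k X0.

  Upper bound: expand V[S_N]. Since A preserves volume, A^{-m} with m the smallest exponent can be
  applied to every mixed volume that occurs, which bounds it by M[X0]; the weights t^k / k! add up
  to e^t. Lower bound: by the Brunn-Minkowski inequality, proved after Hadwiger and Ohmann by
  cutting finite unions of boxes, V[S_N]^(1/n) is at least \<Sum>k\<le>N. (t^k / k!) V[X0]^(1/n).
*)

theory Submission
  imports Defs "HOL-Combinatorics.Multiset_Permutations"
begin

section \<open>Minkowski sums of convex bodies\<close>

lemma mem_sum_scaleR_image_iff:
  fixes K :: "'i \<Rightarrow> 'a::real_vector set"
  assumes "finite I"
  shows "x \<in> (\<Sum>i\<in>I. (*\<^sub>R) (l i) ` K i) \<longleftrightarrow> (\<exists>s. (\<forall>i\<in>I. s i \<in> K i) \<and> x = (\<Sum>i\<in>I. l i *\<^sub>R s i))"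
proof
  assume "x \<in> (\<Sum>i\<in>I. (*\<^sub>R) (l i) ` K i)"
  then obtain s where s: "\<forall>i\<in>I. s i \<in> (*\<^sub>R) (l i) ` K i" "x = sum s I"
    unfolding set_sum_alt[OF assms] by auto
  then have "\<forall>i\<in>I. \<exists>k. k \<in> K i \<and> s i = l i *\<^sub>R k" by auto
  then obtain k where "\<forall>i\<in>I. k i \<in> K i \<and> s i = l i *\<^sub>R k i" by metis
  then show "\<exists>s. (\<forall>i\<in>I. s i \<in> K i) \<and> x = (\<Sum>i\<in>I. l i *\<^sub>R s i)"
    using s by (intro exI[of _ k]) auto
next
  assume "\<exists>s. (\<forall>i\<in>I. s i \<in> K i) \<and> x = (\<Sum>i\<in>I. l i *\<^sub>R s i)"
  then show "x \<in> (\<Sum>i\<in>I. (*\<^sub>R) (l i) ` K i)"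
    unfolding set_sum_alt[OF assms] by auto
qed

lemma linear_image_set_plus:
  assumes "linear f"
  shows "f ` (K + L) = f ` K + f ` L"
  by (fastforce simp: set_plus_def linear_add[OF assms] image_iff)

lemma linear_image_set_sum:
  assumes "linear f"
  shows "f ` (\<Sum>i\<in>I. K i) = (\<Sum>i\<in>I. f ` K i)"
  using sum_set_linear[of "image f" K I] linear_image_set_plus[OF assms] linear_0[OF assms]
  by (simp add: o_def)

lemma conv_bodiesI: "K \<noteq> {} \<Longrightarrow> convex K \<Longrightarrow> compact K \<Longrightarrow> K \<in> conv_bodies"
  and conv_bodiesD: "K \<in> conv_bodies \<Longrightarrow> K \<noteq> {}" "K \<in> conv_bodies \<Longrightarrow> convex K"
    "K \<in> conv_bodies \<Longrightarrow> compact K"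
  by (auto simp: conv_bodies_def)

lemma compact_set_plus:
  fixes K :: "'a::real_normed_vector set"
  shows "compact K \<Longrightarrow> compact L \<Longrightarrow> compact (K + L)"
  unfolding set_plus_def using compact_sums by (force intro: arg_cong[where f = compact, THEN iffD1, rotated])

lemma conv_bodies_plus: "K \<in> conv_bodies \<Longrightarrow> L \<in> conv_bodies \<Longrightarrow> K + L \<in> conv_bodies"
  by (auto simp: conv_bodies_def convex_set_plus compact_set_plus)

lemma conv_bodies_singleton: "{x} \<in> conv_bodies"
  by (simp add: conv_bodies_def)

lemma conv_bodies_sum: "(\<And>i. i \<in> I \<Longrightarrow> K i \<in> conv_bodies) \<Longrightarrow> (\<Sum>i\<in>I. K i) \<in> conv_bodies"
  by (induction I rule: infinite_finite_induct)
     (auto simp: conv_bodies_plus conv_bodies_singleton set_zero)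

lemma conv_bodies_linear_image:
  assumes "linear f" "K \<in> conv_bodies"
  shows "f ` K \<in> conv_bodies"
  using assms by (auto simp: conv_bodies_def convex_linear_image compact_continuous_image
    linear_continuous_on linear_linear)

lemma conv_bodies_scaleR: "K \<in> conv_bodies \<Longrightarrow> (*\<^sub>R) c ` K \<in> conv_bodies"
  by (rule conv_bodies_linear_image) auto

lemma conv_bodies_lmeasurable: "K \<in> conv_bodies \<Longrightarrow> K \<in> lmeasurable"
  by (simp add: conv_bodiesD lmeasurable_compact)

section \<open>Polarization of the determinant\<close>

definition polarization :: "nat \<Rightarrow> (nat set \<Rightarrow> real) \<Rightarrow> real" where
  "polarization n F = (\<Sum>S\<in>Pow {..<n}. (-1) ^ (n - card S) * F S) / fact n"

lemma sum_alternating_supersets: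
  assumes "finite U" "R \<subseteq> U"
  shows "(\<Sum>S\<in>Pow U. if R \<subseteq> S then (-1) ^ (card U - card S) else 0) = (if R = U then 1 else 0 :: real)"
proof -
  have "(\<Prod>x\<in>U. 1 - (if x \<in> R then 0 else 1 :: real)) =
      (\<Sum>S\<in>Pow U. (-1) ^ (card U - card S) * (\<Prod>x\<in>S. 1) * (\<Prod>x\<in>U-S. if x \<in> R then 0 else 1))"
    by (rule prod_diff_conv_sum') fact
  also have "\<dots> = (\<Sum>S\<in>Pow U. if R \<subseteq> S then (-1) ^ (card U - card S) else 0)"
  proof (rule sum.cong)
    fix S assume "S \<in> Pow U"
    then have "(\<Prod>x\<in>U-S. if x \<in> R then 0 else 1 :: real) = (if R \<subseteq> S then 1 else 0)"
      using assms by (auto intro!: prod.neutral)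
    then show "(-1) ^ (card U - card S) * (\<Prod>x\<in>S. 1) * (\<Prod>x\<in>U-S. if x \<in> R then 0 else 1) =
        (if R \<subseteq> S then (-1) ^ (card U - card S) else (0::real))" by simp
  qed auto
  also have "(\<Prod>x\<in>U. 1 - (if x \<in> R then 0 else 1 :: real)) = (if R = U then 1 else 0)"
  proof (cases "R = U")
    case False
    then obtain x where "x \<in> U" "x \<notin> R" using assms by auto
    then show ?thesis using assms False by auto
  qed (auto intro!: prod.neutral)
  finally show ?thesis by simp
qed

lemma polarization_sum:
  assumes "finite G" "\<And>g. g \<in> G \<Longrightarrow> R g \<subseteq> {..<n}"
    and F: "\<And>S. S \<subseteq> {..<n} \<Longrightarrow> F S = (\<Sum>g\<in>G. if R g \<subseteq> S then D g else 0)"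
  shows "polarization n F = (\<Sum>g\<in>{g \<in> G. R g = {..<n}}. D g) / fact n"
proof -
  have "(\<Sum>S\<in>Pow {..<n}. (-1) ^ (n - card S) * F S) =
      (\<Sum>S\<in>Pow {..<n}. \<Sum>g\<in>G. D g * (if R g \<subseteq> S then (-1) ^ (card {..<n} - card S) else 0))"
    by (rule sum.cong) (auto simp: F sum_distrib_left intro!: sum.cong)
  also have "\<dots> = (\<Sum>g\<in>G. D g * (\<Sum>S\<in>Pow {..<n}. if R g \<subseteq> S then (-1) ^ (card {..<n} - card S) else 0))"
    by (subst sum.swap) (simp only: sum_distrib_left)
  also have "\<dots> = (\<Sum>g\<in>G. if R g = {..<n} then D g else 0)"
    by (rule sum.cong) (auto simp: sum_alternating_supersets assms(2))
  also have "\<dots> = (\<Sum>g\<in>{g \<in> G. R g = {..<n}}. D g)"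
    using assms(1) by (simp add: sum.inter_filter)
  finally show ?thesis by (simp add: polarization_def)
qed

lemma polarization_cong:
  "(\<And>S. S \<subseteq> {..<n} \<Longrightarrow> F S = G S) \<Longrightarrow> polarization n F = polarization n G"
  unfolding polarization_def by (auto intro!: sum.cong)

lemma tendsto_polarization:
  assumes "\<And>S. S \<subseteq> {..<n} \<Longrightarrow> ((\<lambda>x. F x S) \<longlongrightarrow> G S) net"
  shows "((\<lambda>x. polarization n (F x)) \<longlongrightarrow> polarization n G) net"
  unfolding polarization_def using assms by (auto intro!: tendsto_intros)

lemma polarization_permute:
  assumes p: "p permutes {..<n}"
  shows "polarization n (\<lambda>S. F (p ` S)) = polarization n F"
proof -
  have "inj p" using p permutes_inj by blast
  then have "card (p ` S) = card S" for S by (simp add: card_image inj_on_subset)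
  moreover have "bij_betw (image p) (Pow {..<n}) (Pow {..<n})"
    using p by (intro bij_betw_Pow permutes_imp_bij)
  ultimately have "(\<Sum>S\<in>Pow {..<n}. (-1) ^ (n - card S) * F (p ` S)) =
      (\<Sum>S\<in>Pow {..<n}. (-1) ^ (n - card S) * F S)"
    by (intro sum.reindex_bij_betw[where g = "\<lambda>S. (-1) ^ (n - card S) * F S", THEN trans[rotated]] sum.cong) auto
  then show ?thesis by (simp add: polarization_def)
qed

lemma card_bijections_lessThan:
  "card {f :: 'n::finite \<Rightarrow> nat. bij_betw f UNIV {..<CARD('n)}} = fact CARD('n)"
proof -
  obtain e :: "'n \<Rightarrow> nat" where e: "bij_betw e UNIV {..<CARD('n)}"
    by (metis finite_same_card_bij finite_lessThan finite card_lessThan)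
  have "bij_betw (\<lambda>p. p \<circ> e) {p. p permutes {..<CARD('n)}} {f. bij_betw f UNIV {..<CARD('n)}}"
  proof (rule bij_betw_byWitness[where f' = "\<lambda>f j. if j < CARD('n) then f (inv e j) else j"])
    have inj: "inj e" using e by (simp add: bij_betw_def)
    have ei: "e (inv e j) = j" if "j < CARD('n)" for j
      using that e by (metis bij_betw_def f_inv_into_f lessThan_iff)
    have lt: "e i < CARD('n)" for i using e by (auto simp: bij_betw_def)
    show "\<forall>p\<in>{p. p permutes {..<CARD('n)}}.
        (\<lambda>j. if j < CARD('n) then (p \<circ> e) (inv e j) else j) = p"
      by (auto simp: fun_eq_iff ei permutes_def)
    show "\<forall>f\<in>{f. bij_betw f UNIV {..<CARD('n)}}.
        (\<lambda>j. if j < CARD('n) then f (inv e j) else j) \<circ> e = f"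
      using lt inj by (auto simp: fun_eq_iff)
    show "(\<lambda>p. p \<circ> e) ` {p. p permutes {..<CARD('n)}} \<subseteq> {f. bij_betw f UNIV {..<CARD('n)}}"
      using e by (auto intro: bij_betw_trans dest: permutes_imp_bij)
    show "(\<lambda>f j. if j < CARD('n) then f (inv e j) else j) ` {f. bij_betw f UNIV {..<CARD('n)}}
        \<subseteq> {p. p permutes {..<CARD('n)}}"
    proof clarify
      fix f :: "'n \<Rightarrow> nat" assume f: "bij_betw f UNIV {..<CARD('n)}"
      have "bij_betw (f \<circ> inv e) {..<CARD('n)} {..<CARD('n)}"
        using e f by (intro bij_betw_trans[OF _ f] bij_betw_inv_into)
      then have "bij_betw (\<lambda>j. if j < CARD('n) then f (inv e j) else j) {..<CARD('n)} {..<CARD('n)}"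
        by (rule bij_betw_cong[THEN iffD1, rotated]) auto
      then show "(\<lambda>j. if j < CARD('n) then f (inv e j) else j) permutes {..<CARD('n)}"
        by (rule bij_imp_permutes) auto
    qed
  qed
  then show ?thesis using card_permutations[of "{..<CARD('n)}"] by (metis bij_betw_same_card card_lessThan finite_lessThan)
qed

lemma det_sum_scaleR:
  fixes M :: "'i \<Rightarrow> real^'n^'n"
  assumes "finite I"
  shows "det (\<Sum>i\<in>I. l i *\<^sub>R M i) =
    (\<Sum>g | \<forall>r. g r \<in> I. (\<Prod>r\<in>UNIV. l (g r)) * det (\<chi> r. M (g r) $ r))"
proof -
  have "det (\<Sum>i\<in>I. l i *\<^sub>R M i) =
      (\<Sum>p | p permutes UNIV. of_int (sign p) * (\<Prod>r\<in>UNIV. \<Sum>i\<in>I. l i * M i $ r $ p r))"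
    by (simp add: det_def)
  also have "\<dots> = (\<Sum>p | p permutes UNIV. \<Sum>g | \<forall>r. g r \<in> I.
      (\<Prod>r\<in>UNIV. l (g r)) * (of_int (sign p) * (\<Prod>r\<in>UNIV. M (g r) $ r $ p r)))"
    by (simp add: prod_sum_PiE assms PiE_UNIV_domain Pi_def prod.distrib sum_distrib_left mult_ac)
  also have "\<dots> = (\<Sum>g | \<forall>r. g r \<in> I. (\<Prod>r\<in>UNIV. l (g r)) * det (\<chi> r. M (g r) $ r))"
    by (subst sum.swap) (simp add: det_def sum_distrib_left)
  finally show ?thesis .
qed

lemma polarization_det:
  fixes M :: "nat \<Rightarrow> real^'n^'n"
  shows "polarization CARD('n) (\<lambda>S. det (\<Sum>j\<in>S. M j)) =
    (\<Sum>f | bij_betw f UNIV {..<CARD('n)}. det (\<chi> r. M (f r) $ r)) / fact CARD('n)"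
proof -
  define G where "G = {g :: 'n \<Rightarrow> nat. \<forall>r. g r \<in> {..<CARD('n)}}"
  have fin: "finite G" unfolding G_def
    using finite_PiE[of "UNIV :: 'n set" "\<lambda>_. {..<CARD('n)}"] by (simp add: PiE_def Pi_def)
  have "polarization CARD('n) (\<lambda>S. det (\<Sum>j\<in>S. M j)) =
      (\<Sum>g\<in>{g \<in> G. range g = {..<CARD('n)}}. det (\<chi> r. M (g r) $ r)) / fact CARD('n)"
  proof (rule polarization_sum[OF fin])
    fix S assume S: "S \<subseteq> {..<CARD('n)}"
    then have "finite S" using finite_subset by blast
    have "det (\<Sum>j\<in>S. M j) = (\<Sum>g | \<forall>r. g r \<in> S. det (\<chi> r. M (g r) $ r))"
      using det_sum_scaleR[OF \<open>finite S\<close>, of "\<lambda>_. 1" M] by simp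
    also have "{g. \<forall>r. g r \<in> S} = {g \<in> G. range g \<subseteq> S}"
      using S by (auto simp: G_def)
    also have "(\<Sum>g\<in>\<dots>. det (\<chi> r. M (g r) $ r)) = (\<Sum>g\<in>G. if range g \<subseteq> S then det (\<chi> r. M (g r) $ r) else 0)"
      by (rule sum.inter_filter) (rule fin)
    finally show "det (\<Sum>j\<in>S. M j) = \<dots>" .
  qed (auto simp: G_def)
  also have "{g \<in> G. range g = {..<CARD('n)}} = {f. bij_betw f UNIV {..<CARD('n)}}"
    by (auto simp: G_def bij_betw_def intro!: eq_card_imp_inj_on)
  finally show ?thesis .
qed

lemma det_sum_polarized:
  fixes M :: "nat \<Rightarrow> real^'n^'n"
  shows "det (\<Sum>i<m. l i *\<^sub>R M i) =
    (\<Sum>is | length is = CARD('n) \<and> set is \<subseteq> {..<m}.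
       polarization CARD('n) (\<lambda>S. det (\<Sum>j\<in>S. M (is ! j))) * prod_list (map l is))"
proof -
  define L where "L = {is. length is = CARD('n) \<and> set is \<subseteq> {..<m}}"
  define B where "B = {f :: 'n \<Rightarrow> nat. bij_betw f UNIV {..<CARD('n)}}"
  have finB: "finite B"
    using card_bijections_lessThan[where 'n = 'n] by (metis B_def card.infinite fact_nonzero)
  have *: "(\<Sum>is\<in>L. det (\<chi> r. M (is ! f r) $ r) * prod_list (map l is)) = det (\<Sum>i<m. l i *\<^sub>R M i)"
    if "f \<in> B" for f
  proof -
    have f: "bij_betw f UNIV {..<CARD('n)}" using that by (simp add: B_def)
    then have lt: "f r < CARD('n)" for r by (auto simp: bij_betw_def)
    have fi: "f (inv f j) = j" if "j < CARD('n)" for j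
      using that f by (metis bij_betw_def f_inv_into_f lessThan_iff)
    have inv: "inv f (f r) = r" for r using f by (simp add: bij_betw_def)
    have "(\<Sum>is\<in>L. det (\<chi> r. M (is ! f r) $ r) * prod_list (map l is)) =
        (\<Sum>g | \<forall>r. g r \<in> {..<m}. (\<Prod>r\<in>UNIV. l (g r)) * det (\<chi> r. M (g r) $ r))"
    proof (rule sum.reindex_bij_witness[where j = "\<lambda>is r. is ! f r" and i = "\<lambda>g. map (g \<circ> inv f) [0..<CARD('n)]"])
      fix "is" assume "is \<in> L"
      then have "is": "length is = CARD('n)" "set is \<subseteq> {..<m}" by (auto simp: L_def)
      show "map ((\<lambda>r. is ! f r) \<circ> inv f) [0..<CARD('n)] = is"
        by (rule nth_equalityI) (auto simp: "is" fi)
      show "(\<lambda>r. is ! f r) \<in> {g. \<forall>r. g r \<in> {..<m}}"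
        using "is" lt by (auto simp: subset_iff)
      have "prod_list (map l is) = (\<Prod>j<CARD('n). l (is ! j))"
        using "is" by (simp add: prod.list_conv_set_nth atLeast0LessThan)
      also have "\<dots> = (\<Prod>r\<in>UNIV. l (is ! f r))"
        using f by (simp add: prod.reindex_bij_betw[OF f, of "\<lambda>j. l (is ! j)"])
      finally show "(\<Prod>r\<in>UNIV. l (is ! f r)) * det (\<chi> r. M (is ! f r) $ r) =
          det (\<chi> r. M (is ! f r) $ r) * prod_list (map l is)" by simp
    qed (auto simp: inv lt L_def fun_eq_iff)
    also have "\<dots> = det (\<Sum>i<m. l i *\<^sub>R M i)"
      by (rule det_sum_scaleR[symmetric]) simp
    finally show ?thesis .
  qed
  have "(\<Sum>is\<in>L. polarization CARD('n) (\<lambda>S. det (\<Sum>j\<in>S. M (is ! j))) * prod_list (map l is)) =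
      (\<Sum>is\<in>L. (\<Sum>f\<in>B. det (\<chi> r. M (is ! f r) $ r) * prod_list (map l is) / fact CARD('n)))"
    by (simp add: polarization_det B_def sum_distrib_right sum_divide_distrib)
  also have "\<dots> = (\<Sum>f\<in>B. \<Sum>is\<in>L. det (\<chi> r. M (is ! f r) $ r) * prod_list (map l is)) / fact CARD('n)"
    by (subst sum.swap) (simp add: sum_divide_distrib)
  also have "\<dots> = det (\<Sum>i<m. l i *\<^sub>R M i)"
    using card_bijections_lessThan[where 'n = 'n] by (simp add: * B_def[symmetric])
  finally show ?thesis by (simp add: L_def)
qed

section \<open>Log-sum-exp functions\<close>

definition softmax :: "'a::euclidean_space set \<Rightarrow> 'a \<Rightarrow> 'a \<Rightarrow> real" where
  "softmax V x v = exp (v \<bullet> x) / (\<Sum>u\<in>V. exp (u \<bullet> x))"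

definition lse :: "'a::euclidean_space set \<Rightarrow> 'a \<Rightarrow> real" where
  "lse V x = ln (\<Sum>v\<in>V. exp (v \<bullet> x))"

definition lse_grad :: "'a::euclidean_space set \<Rightarrow> 'a \<Rightarrow> 'a" where
  "lse_grad V x = (\<Sum>v\<in>V. softmax V x v *\<^sub>R v)"

definition lse_hess :: "(real^'n) set \<Rightarrow> real^'n \<Rightarrow> real^'n^'n" where
  "lse_hess V x = (\<chi> i j. \<Sum>v\<in>V. softmax V x v * (v $ j - lse_grad V x $ j) * v $ i)"

lemma exp_sum_pos: "finite V \<Longrightarrow> V \<noteq> {} \<Longrightarrow> 0 < (\<Sum>v\<in>V. exp (v \<bullet> x) :: real)"
  by (simp add: sum_pos)

lemma softmax_pos: "finite V \<Longrightarrow> V \<noteq> {} \<Longrightarrow> 0 < softmax V x v"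
  by (simp add: softmax_def exp_sum_pos)

lemma sum_softmax: "finite V \<Longrightarrow> V \<noteq> {} \<Longrightarrow> (\<Sum>v\<in>V. softmax V x v) = 1"
  using exp_sum_pos[of V x] by (simp add: softmax_def flip: sum_divide_distrib)

lemma sum_softmax_inner: "(\<Sum>v\<in>V. softmax V x v * (v \<bullet> h)) = lse_grad V x \<bullet> h"
  by (simp add: lse_grad_def inner_sum_left)

lemma lse_grad_in_hull:
  assumes "finite V" "V \<noteq> {}"
  shows "lse_grad V x \<in> convex hull V"
  unfolding lse_grad_def
  by (rule convex_sum[OF assms(1) convex_convex_hull])
     (use assms in \<open>auto simp: sum_softmax less_imp_le[OF softmax_pos] hull_inc\<close>)

lemma has_derivative_lse:
  assumes "finite V" "V \<noteq> {}"
  shows "(lse V has_derivative (\<lambda>h. lse_grad V x \<bullet> h)) (at x)"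
proof -
  have "(lse V has_derivative (\<lambda>h. (\<Sum>v\<in>V. exp (v \<bullet> x) * (v \<bullet> h)) / (\<Sum>v\<in>V. exp (v \<bullet> x)))) (at x)"
    unfolding lse_def[abs_def]
    by (auto intro!: derivative_eq_intros exp_sum_pos assms simp: divide_inverse mult_ac)
  moreover have "(\<Sum>v\<in>V. exp (v \<bullet> x) * (v \<bullet> h)) / (\<Sum>v\<in>V. exp (v \<bullet> x)) = lse_grad V x \<bullet> h" for h
    by (simp add: sum_divide_distrib softmax_def flip: sum_softmax_inner)
  ultimately show ?thesis by simp
qed

lemma has_derivative_softmax:
  assumes "finite V" "V \<noteq> {}"
  shows "((\<lambda>x. softmax V x v) has_derivative (\<lambda>h. softmax V x v * ((v - lse_grad V x) \<bullet> h))) (at x)"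
proof -
  let ?Z = "\<lambda>x. \<Sum>u\<in>V. exp (u \<bullet> x)"
  have Z: "?Z x \<noteq> 0" using exp_sum_pos[OF assms, of x] by simp
  have "((\<lambda>x. softmax V x v) has_derivative
      (\<lambda>h. (exp (v \<bullet> x) * (v \<bullet> h) * ?Z x - exp (v \<bullet> x) * (\<Sum>u\<in>V. exp (u \<bullet> x) * (u \<bullet> h))) / (?Z x * ?Z x))) (at x)"
    unfolding softmax_def
    by (rule has_derivative_eq_rhs, rule has_derivative_divide')
       (use Z in \<open>auto intro!: derivative_eq_intros simp: mult_ac\<close>)
  moreover have "(exp (v \<bullet> x) * (v \<bullet> h) * ?Z x - exp (v \<bullet> x) * (\<Sum>u\<in>V. exp (u \<bullet> x) * (u \<bullet> h))) / (?Z x * ?Z x)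
      = softmax V x v * ((v - lse_grad V x) \<bullet> h)" for h
  proof -
    have "lse_grad V x \<bullet> h = (\<Sum>u\<in>V. exp (u \<bullet> x) * (u \<bullet> h)) / ?Z x"
      by (simp add: sum_divide_distrib softmax_def flip: sum_softmax_inner)
    then show ?thesis using Z by (simp add: softmax_def inner_diff_left field_simps)
  qed
  ultimately show ?thesis by simp
qed

lemma lse_hess_mult_vec:
  "lse_hess V x *v h = (\<Sum>v\<in>V. (softmax V x v * ((v - lse_grad V x) \<bullet> h)) *\<^sub>R v)"
proof -
  have "(\<Sum>j\<in>UNIV. (\<Sum>v\<in>V. softmax V x v * (v $ j - lse_grad V x $ j) * v $ i) * h $ j) =
      (\<Sum>v\<in>V. (softmax V x v * (\<Sum>j\<in>UNIV. (v $ j - lse_grad V x $ j) * h $ j)) * v $ i)" for i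
    unfolding sum_distrib_right by (subst sum.swap) (simp add: sum_distrib_left sum_distrib_right mult_ac)
  then show ?thesis
    by (simp add: vec_eq_iff lse_hess_def matrix_vector_mult_def inner_vec_def)
qed

lemma has_derivative_lse_grad:
  fixes V :: "(real^'n) set"
  assumes "finite V" "V \<noteq> {}"
  shows "(lse_grad V has_derivative (\<lambda>h. lse_hess V x *v h)) (at x)"
proof -
  have "lse_grad V = (\<lambda>x. \<Sum>v\<in>V. softmax V x v *\<^sub>R v)" by (simp add: lse_grad_def fun_eq_iff)
  then show ?thesis unfolding lse_hess_mult_vec
    by (subst \<open>lse_grad V = _\<close>) (intro has_derivative_sum has_derivative_scaleR_left has_derivative_softmax assms)
qed

lemma lse_hess_form:
  assumes "finite V" "V \<noteq> {}"
  shows "h \<bullet> (lse_hess V x *v h) = (\<Sum>v\<in>V. softmax V x v * ((v - lse_grad V x) \<bullet> h)\<^sup>2)"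
proof -
  have "(\<Sum>v\<in>V. softmax V x v * ((v - lse_grad V x) \<bullet> h)) = 0"
    using sum_softmax[OF assms, of x]
    by (simp add: inner_diff_left right_diff_distrib sum_subtractf sum_softmax_inner flip: sum_distrib_right)
  then have 0: "(\<Sum>v\<in>V. softmax V x v * ((v - lse_grad V x) \<bullet> h) * (lse_grad V x \<bullet> h)) = 0"
    by (simp flip: sum_distrib_right)
  have "h \<bullet> (lse_hess V x *v h) = (\<Sum>v\<in>V. softmax V x v * ((v - lse_grad V x) \<bullet> h) * (v \<bullet> h))"
    by (simp add: lse_hess_mult_vec inner_sum_right inner_commute)
  also have "\<dots> = \<dots> - (\<Sum>v\<in>V. softmax V x v * ((v - lse_grad V x) \<bullet> h) * (lse_grad V x \<bullet> h))"
    using 0 by simp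
  also have "\<dots> = (\<Sum>v\<in>V. softmax V x v * ((v - lse_grad V x) \<bullet> h)\<^sup>2)"
    by (simp add: power2_eq_square inner_diff_left algebra_simps flip: sum_subtractf)
  finally show ?thesis .
qed

lemma lse_hess_form_nonneg:
  "finite V \<Longrightarrow> V \<noteq> {} \<Longrightarrow> 0 \<le> h \<bullet> (lse_hess V x *v h)"
  by (simp add: lse_hess_form sum_nonneg less_imp_le[OF softmax_pos])

lemma lse_hess_form_eq_0:
  assumes "finite V" "V \<noteq> {}" "h \<bullet> (lse_hess V x *v h) = 0" "v \<in> V"
  shows "v \<bullet> h = lse_grad V x \<bullet> h"
proof -
  have "softmax V x v * ((v - lse_grad V x) \<bullet> h)\<^sup>2 = 0"
    using assms sum_nonneg_eq_0_iff[of V "\<lambda>v. softmax V x v * ((v - lse_grad V x) \<bullet> h)\<^sup>2"]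
    by (simp add: lse_hess_form less_imp_le[OF softmax_pos])
  then show ?thesis using softmax_pos[OF assms(1,2), of x v] by (simp add: inner_diff_left)
qed

lemma lse_hess_mult_vec_eq_0:
  assumes "finite V" "V \<noteq> {}" "\<And>v. v \<in> V \<Longrightarrow> v \<bullet> h = c"
  shows "lse_hess V x *v h = 0"
proof -
  have "lse_grad V x \<bullet> h = (\<Sum>v\<in>V. softmax V x v * c)"
    unfolding sum_softmax_inner[symmetric] using assms(3) by (intro sum.cong) auto
  then have "lse_grad V x \<bullet> h = c"
    using sum_softmax[OF assms(1,2), of x] by (simp flip: sum_distrib_right)
  then show ?thesis by (simp add: lse_hess_mult_vec inner_diff_left assms(3))
qed

lemma inner_le_lse:
  assumes "finite V" "p \<in> convex hull V"
  shows "p \<bullet> x \<le> lse V x"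
proof -
  have "V \<noteq> {}" using assms(2) by auto
  have "v \<bullet> x \<le> lse V x" if "v \<in> V" for v
  proof -
    have "exp (v \<bullet> x) \<le> (\<Sum>u\<in>V. exp (u \<bullet> x))"
      using that assms(1) by (intro member_le_sum) auto
    then show ?thesis unfolding lse_def
      using exp_sum_pos[OF assms(1) \<open>V \<noteq> {}\<close>] by (subst ln_ge_iff) auto
  qed
  then have "V \<subseteq> {p. p \<bullet> x \<le> lse V x}" by auto
  moreover have "convex {p. p \<bullet> x \<le> lse V x}"
    using convex_halfspace_le[of x "lse V x"] by (simp add: inner_commute)
  ultimately show ?thesis using assms(2) hull_minimal by blast
qed

lemma det_nonneg_if_psd:
  fixes M :: "real^'n^'n"
  assumes psd: "\<And>h. 0 \<le> h \<bullet> (M *v h)"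
  shows "0 \<le> det M"
proof (rule ccontr)
  assume "\<not> 0 \<le> det M"
  define f where "f s = det ((1 - s) *\<^sub>R mat 1 + s *\<^sub>R M)" for s :: real
  have cont: "continuous_on {0..1} f"
    unfolding f_def det_def by (auto intro!: continuous_intros)
  have "f 1 \<le> 0" "0 \<le> f 0" using \<open>\<not> 0 \<le> det M\<close> by (simp_all add: f_def)
  then obtain s where s: "0 \<le> s" "s \<le> 1" "f s = 0"
    using IVT2'[of f 1 0 0] cont by auto
  then have "\<not> invertible ((1 - s) *\<^sub>R mat 1 + s *\<^sub>R M)"
    by (simp add: invertible_det_nz f_def)
  then obtain h where h: "h \<noteq> 0" "((1 - s) *\<^sub>R mat 1 + s *\<^sub>R M) *v h = 0"
    unfolding invertible_left_inverse matrix_left_invertible_ker by blast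
  have "0 = h \<bullet> (((1 - s) *\<^sub>R mat 1 + s *\<^sub>R M) *v h)" using h by simp
  also have "\<dots> = (1 - s) * (h \<bullet> h) + s * (h \<bullet> (M *v h))"
    by (simp add: matrix_vector_mult_add_rdistrib scaleR_matrix_vector_assoc[symmetric] inner_add_right)
  finally have "(1 - s) * (h \<bullet> h) = 0"
    using s psd[of h] by (smt (verit) inner_ge_zero mult_nonneg_nonneg)
  then have "s = 1" using h by simp
  then show False using s \<open>\<not> 0 \<le> det M\<close> by (simp add: f_def)
qed

lemma lse_grad_diff:
  fixes V :: "(real^'n) set"
  assumes "finite V" "V \<noteq> {}"
  obtains z where "(lse_grad V x - lse_grad V y) \<bullet> (x - y) = (x - y) \<bullet> (lse_hess V z *v (x - y))"
proof -
  define f where "f t = lse_grad V (y + t *\<^sub>R (x - y)) \<bullet> (x - y)" for t :: real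
  have der: "(f has_derivative (\<lambda>t. (lse_hess V (y + s *\<^sub>R (x - y)) *v (t *\<^sub>R (x - y))) \<bullet> (x - y))) (at s within {0..1})" for s
    unfolding f_def
    by (rule has_derivative_inner_left, rule has_derivative_compose[OF _ has_derivative_lse_grad[OF assms]])
       (auto intro!: derivative_eq_intros)
  obtain s where "f 1 - f 0 = (lse_hess V (y + s *\<^sub>R (x - y)) *v ((1 - 0) *\<^sub>R (x - y))) \<bullet> (x - y)"
    using mvt_very_simple[where f = f, OF _ der] by auto
  then show ?thesis by (intro that[of "y + s *\<^sub>R (x - y)"]) (simp add: f_def inner_diff_left inner_diff_right inner_commute)
qed

section \<open>Volumes of sums of polytopes\<close>

lemma sum_scaleR_matrix_vector_mult:
  fixes H :: "'i \<Rightarrow> real^'n^'m"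
  shows "(\<Sum>i\<in>I. l i *\<^sub>R H i) *v h = (\<Sum>i\<in>I. l i *\<^sub>R (H i *v h))"
  by (induction I rule: infinite_finite_induct)
     (auto simp: matrix_vector_mult_add_rdistrib scaleR_matrix_vector_assoc)

lemma scaled_sum_subset_hyperplane:
  fixes K :: "'i \<Rightarrow> 'a::euclidean_space set"
  assumes "finite I" "\<And>i. i \<in> I \<Longrightarrow> K i \<noteq> {}"
    and sub: "(\<Sum>i\<in>I. (*\<^sub>R) (l i) ` K i) \<subseteq> {x. a \<bullet> x = b}"
    and "i \<in> I" "l i \<noteq> 0"
  obtains c where "\<And>v. v \<in> K i \<Longrightarrow> v \<bullet> a = c"
proof -
  have "\<forall>j\<in>I. \<exists>x. x \<in> K j" using assms(2) by auto
  then obtain s where s: "\<And>j. j \<in> I \<Longrightarrow> s j \<in> K j" by metis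
  have *: "a \<bullet> (\<Sum>j\<in>I. l j *\<^sub>R (s(i := v)) j) = b" if "v \<in> K i" for v
  proof -
    have "\<forall>j\<in>I. (s(i := v)) j \<in> K j" using s that by simp
    then have "(\<Sum>j\<in>I. l j *\<^sub>R (s(i := v)) j) \<in> (\<Sum>i\<in>I. (*\<^sub>R) (l i) ` K i)"
      unfolding mem_sum_scaleR_image_iff[OF assms(1)] by (intro exI[of _ "s(i := v)"]) auto
    then show ?thesis using sub by auto
  qed
  have "(\<Sum>j\<in>I. l j *\<^sub>R (s(i := v)) j) = l i *\<^sub>R v + (\<Sum>j\<in>I-{i}. l j *\<^sub>R s j)" for v
    using assms(1,4) by (simp add: sum.remove)
  then have "l i * (v \<bullet> a) = b - a \<bullet> (\<Sum>j\<in>I-{i}. l j *\<^sub>R s j)" if "v \<in> K i" for v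
    using *[OF that] by (simp add: inner_add_right inner_commute)
  then show ?thesis
    using assms(5) by (intro that[of "(b - a \<bullet> (\<Sum>j\<in>I-{i}. l j *\<^sub>R s j)) / l i"]) (simp add: field_simps)
qed

lemma interior_subset_range_sum_lse_grad:
  fixes V :: "'i \<Rightarrow> 'a::euclidean_space set"
  assumes I: "finite I" and V: "\<And>i. i \<in> I \<Longrightarrow> finite (V i)" "\<And>i. i \<in> I \<Longrightarrow> V i \<noteq> {}"
    and l: "\<And>i. i \<in> I \<Longrightarrow> 0 \<le> l i"
    and y: "y \<in> interior (\<Sum>i\<in>I. (*\<^sub>R) (l i) ` (convex hull V i))"
  shows "y \<in> range (\<lambda>x. \<Sum>i\<in>I. l i *\<^sub>R lse_grad (V i) x)"
proof -
  let ?P = "\<Sum>i\<in>I. (*\<^sub>R) (l i) ` (convex hull V i)"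
  define F where "F x = (\<Sum>i\<in>I. l i * lse (V i) x) - y \<bullet> x" for x
  have der: "(F has_derivative (\<lambda>h. (\<Sum>i\<in>I. l i * (lse_grad (V i) x \<bullet> h)) - y \<bullet> h)) (at x)" for x
    unfolding F_def using V
    by (auto intro!: has_derivative_diff has_derivative_sum has_derivative_mult_right has_derivative_lse
        has_derivative_inner_right)
  then have cont: "continuous_on S F" for S
    by (meson continuous_at_imp_continuous_on has_derivative_continuous)
  have ub: "p \<bullet> x - y \<bullet> x \<le> F x" if "p \<in> ?P" for p x
  proof -
    obtain s where s: "\<forall>i\<in>I. s i \<in> convex hull V i" "p = (\<Sum>i\<in>I. l i *\<^sub>R s i)"
      using \<open>p \<in> ?P\<close> unfolding mem_sum_scaleR_image_iff[OF I] by blast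
    have "p \<bullet> x = (\<Sum>i\<in>I. l i * (s i \<bullet> x))" by (simp add: s inner_sum_left)
    also have "\<dots> \<le> (\<Sum>i\<in>I. l i * lse (V i) x)"
      using s V l by (intro sum_mono mult_left_mono inner_le_lse) auto
    finally show ?thesis by (simp add: F_def)
  qed
  obtain r where r: "r > 0" "cball y r \<subseteq> ?P" using y by (auto simp: mem_interior_cball)
  have coercive: "r * norm x \<le> F x" for x
  proof (cases "x = 0")
    case True
    have "y \<in> ?P" using r by auto
    then show ?thesis using ub[of y x] True by simp
  next
    case False
    have "y + (r / norm x) *\<^sub>R x \<in> ?P" using r False by (intro subsetD[OF r(2)]) (simp add: dist_norm)
    from ub[OF this, of x] False show ?thesis
      by (simp add: inner_add_left dot_square_norm power2_eq_square)
  qed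
  define R where "R = \<bar>F 0\<bar> / r"
  have "0 \<le> R" using r by (simp add: R_def)
  obtain z where z: "z \<in> cball 0 R" "\<And>x. x \<in> cball 0 R \<Longrightarrow> F z \<le> F x"
    using continuous_attains_inf[OF _ _ cont, of "cball 0 R"] \<open>0 \<le> R\<close> by auto
  have "F z \<le> F x" for x
  proof (cases "x \<in> cball 0 R")
    case False
    then have "\<bar>F 0\<bar> < r * norm x" using r by (simp add: R_def field_simps)
    then show ?thesis using coercive[of x] z(2)[of 0] \<open>0 \<le> R\<close> by simp
  qed (use z in auto)
  then have "(\<lambda>h. (\<Sum>i\<in>I. l i * (lse_grad (V i) z \<bullet> h)) - y \<bullet> h) = (\<lambda>h. 0)"
    by (intro differential_zero_maxmin[OF _ open_UNIV der]) auto
  then have "\<And>h. ((\<Sum>i\<in>I. l i *\<^sub>R lse_grad (V i) z) - y) \<bullet> h = 0"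
    by (simp add: fun_eq_iff inner_diff_left inner_sum_left)
  then have "(\<Sum>i\<in>I. l i *\<^sub>R lse_grad (V i) z) = y"
    by (metis inner_eq_zero_iff right_minus_eq)
  then show ?thesis by auto
qed

lemma inj_sum_lse_grad:
  fixes V :: "'i \<Rightarrow> (real^'n) set"
  assumes I: "finite I" and V: "\<And>i. i \<in> I \<Longrightarrow> finite (V i)" "\<And>i. i \<in> I \<Longrightarrow> V i \<noteq> {}"
    and l: "\<And>i. i \<in> I \<Longrightarrow> 0 \<le> l i"
    and int: "interior (\<Sum>i\<in>I. (*\<^sub>R) (l i) ` (convex hull V i)) \<noteq> {}"
  shows "inj (\<lambda>x. \<Sum>i\<in>I. l i *\<^sub>R lse_grad (V i) x)"
proof (rule injI, rule ccontr)
  fix x y assume eq: "(\<Sum>i\<in>I. l i *\<^sub>R lse_grad (V i) x) = (\<Sum>i\<in>I. l i *\<^sub>R lse_grad (V i) y)" and "x \<noteq> y"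
  define w where "w = x - y"
  have *: "\<exists>z. (lse_grad (V i) x - lse_grad (V i) y) \<bullet> w = w \<bullet> (lse_hess (V i) z *v w)" if "i \<in> I" for i
    unfolding w_def using lse_grad_diff[OF V[OF that], of x y] by blast
  then have nn: "0 \<le> (lse_grad (V i) x - lse_grad (V i) y) \<bullet> w" if "i \<in> I" for i
    using lse_hess_form_nonneg V that by metis
  have "(\<Sum>i\<in>I. l i * ((lse_grad (V i) x - lse_grad (V i) y) \<bullet> w)) =
      ((\<Sum>i\<in>I. l i *\<^sub>R lse_grad (V i) x) - (\<Sum>i\<in>I. l i *\<^sub>R lse_grad (V i) y)) \<bullet> w"
    by (simp add: inner_sum_left inner_diff_left right_diff_distrib sum_subtractf)
  then have "(\<Sum>i\<in>I. l i * ((lse_grad (V i) x - lse_grad (V i) y) \<bullet> w)) = 0" using eq by simp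
  then have zero: "l i * ((lse_grad (V i) x - lse_grad (V i) y) \<bullet> w) = 0" if "i \<in> I" for i
    using that nn l by (subst (asm) sum_nonneg_eq_0_iff) (auto simp: I)
  have const: "\<exists>c. \<forall>v\<in>convex hull V i. l i * (v \<bullet> w) = c" if i: "i \<in> I" for i
  proof (cases "l i = 0")
    case False
    then have "(lse_grad (V i) x - lse_grad (V i) y) \<bullet> w = 0" using zero i by auto
    then obtain z where "w \<bullet> (lse_hess (V i) z *v w) = 0" using *[OF i] by metis
    from lse_hess_form_eq_0[OF V[OF i] this] have "V i \<subseteq> {v. w \<bullet> v = lse_grad (V i) z \<bullet> w}"
      by (auto simp: inner_commute)
    then have "convex hull V i \<subseteq> {v. w \<bullet> v = lse_grad (V i) z \<bullet> w}"
      by (intro hull_minimal convex_hyperplane)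
    then have "\<forall>v\<in>convex hull V i. l i * (v \<bullet> w) = l i * (lse_grad (V i) z \<bullet> w)"
      by (auto simp: inner_commute)
    then show ?thesis by blast
  qed auto
  then obtain c where c: "\<And>i v. i \<in> I \<Longrightarrow> v \<in> convex hull V i \<Longrightarrow> l i * (v \<bullet> w) = c i" by metis
  have "(\<Sum>i\<in>I. (*\<^sub>R) (l i) ` (convex hull V i)) \<subseteq> {x. w \<bullet> x = (\<Sum>i\<in>I. c i)}"
    using c by (auto simp: mem_sum_scaleR_image_iff[OF I] inner_sum_left inner_commute[of w] intro!: sum.cong)
  moreover have "interior {x. w \<bullet> x = (\<Sum>i\<in>I. c i)} = {}"
    using \<open>x \<noteq> y\<close> by (simp add: w_def)
  ultimately show False using int interior_mono by blast
qed


theorem has_integral_det_sum_lse_hess: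
  fixes V :: "'i \<Rightarrow> (real^'n::{finite,wellorder}) set"
  assumes I: "finite I" and V: "\<And>i. i \<in> I \<Longrightarrow> finite (V i)" "\<And>i. i \<in> I \<Longrightarrow> V i \<noteq> {}"
    and l: "\<And>i. i \<in> I \<Longrightarrow> 0 \<le> l i"
  shows "((\<lambda>x. det (\<Sum>i\<in>I. l i *\<^sub>R lse_hess (V i) x)) has_integral
    volume (\<Sum>i\<in>I. (*\<^sub>R) (l i) ` (convex hull V i))) UNIV"
proof -
  let ?P = "\<Sum>i\<in>I. (*\<^sub>R) (l i) ` (convex hull V i)"
  have body: "?P \<in> conv_bodies"
    using V by (intro conv_bodies_sum conv_bodies_scaleR conv_bodiesI)
      (auto simp: finite_imp_compact_convex_hull)
  show ?thesis
  proof (cases "interior ?P = {}")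
    case True
    then have "volume ?P = 0"
      using negligible_convex_interior conv_bodiesD(2)[OF body] negligible_imp_measure0 by blast
    moreover have "det (\<Sum>i\<in>I. l i *\<^sub>R lse_hess (V i) x) = 0" for x
    proof -
      obtain a b where ab: "a \<noteq> 0" "?P \<subseteq> {x. a \<bullet> x = b}"
        using empty_interior_subset_hyperplane[OF conv_bodiesD(2)[OF body] True] by blast
      have "l i *\<^sub>R (lse_hess (V i) x *v a) = 0" if i: "i \<in> I" for i
      proof (cases "l i = 0")
        case False
        have "convex hull V j \<noteq> {}" if "j \<in> I" for j using V(2)[OF that] by simp
        from scaled_sum_subset_hyperplane[where K = "\<lambda>i. convex hull V i", OF I this ab(2) i False]
        obtain c where "\<And>v. v \<in> convex hull V i \<Longrightarrow> v \<bullet> a = c" by blast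
        then show ?thesis using lse_hess_mult_vec_eq_0[OF V[OF i]] by (simp add: hull_inc)
      qed simp
      then have "(\<Sum>i\<in>I. l i *\<^sub>R lse_hess (V i) x) *v a = 0"
        unfolding sum_scaleR_matrix_vector_mult by (rule sum.neutral[rule_format])
      then show ?thesis
        using ab(1) invertible_det_nz invertible_left_inverse matrix_left_invertible_ker by blast
    qed
    ultimately show ?thesis by simp
  next
    case False
    define G where "G x = (\<Sum>i\<in>I. l i *\<^sub>R lse_grad (V i) x)" for x
    let ?H = "\<lambda>x. \<Sum>i\<in>I. l i *\<^sub>R lse_hess (V i) x"
    have der: "(G has_derivative (\<lambda>h. ?H x *v h)) (at x)" for x
      unfolding G_def sum_scaleR_matrix_vector_mult using V
      by (auto intro!: has_derivative_sum has_derivative_scaleR_right has_derivative_lse_grad)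
    have inj: "inj G" unfolding G_def by (rule inj_sum_lse_grad) (use assms False in auto)
    have "interior ?P \<subseteq> range G" unfolding G_def
      using interior_subset_range_sum_lse_grad[of I V l] assms by blast
    moreover have "range G \<subseteq> ?P"
    proof (rule image_subsetI)
      fix x
      show "G x \<in> ?P" unfolding mem_sum_scaleR_image_iff[OF I] G_def
        using lse_grad_in_hull[OF V] by (intro exI[of _ "\<lambda>i. lse_grad (V i) x"]) auto
    qed
    ultimately have "(?P - range G) \<union> (range G - ?P) \<subseteq> frontier ?P"
      using conv_bodiesD[OF body] by (auto simp: frontier_def compact_imp_closed)
    then have neg: "negligible ((?P - range G) \<union> (range G - ?P))"
      using negligible_convex_frontier conv_bodiesD(2)[OF body] negligible_subset by blast
    have "range G \<in> lmeasurable" "measure lebesgue (range G) = volume ?P"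
      using lmeasurable_negligible_symdiff[OF conv_bodies_lmeasurable[OF body] neg]
        measure_negligible_symdiff[OF conv_bodies_lmeasurable[OF body] neg] by auto
    then have "((\<lambda>x. \<bar>det (matrix (\<lambda>h. ?H x *v h))\<bar>) has_integral volume ?P) UNIV"
      using has_measure_differentiable_image[where S = UNIV and f = G and f' = "\<lambda>x h. ?H x *v h"] der inj by auto
    moreover have "\<bar>det (matrix (\<lambda>h. ?H x *v h))\<bar> = det (?H x)" for x
    proof -
      have "0 \<le> h \<bullet> (?H x *v h)" for h
        using V l by (auto simp: sum_scaleR_matrix_vector_mult inner_sum_right
          intro!: sum_nonneg mult_nonneg_nonneg lse_hess_form_nonneg)
      then have "0 \<le> det (?H x)" by (rule det_nonneg_if_psd)
      then show ?thesis by simp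
    qed
    ultimately show ?thesis by simp
  qed
qed

section \<open>Minkowski's expansion\<close>

text \<open>The library proves the change of variables theorem and the orthogonal invariance of Lebesgue
  measure only for vectors with a well-ordered index type.\<close>

typedef 'a ranked = "UNIV :: 'a set" by simp

instance ranked :: (finite) finite
proof
  have "(UNIV :: 'a ranked set) = range Abs_ranked"
    by (metis Abs_ranked_cases surjI UNIV_I)
  then show "finite (UNIV :: 'a ranked set)" by (metis finite finite_imageI)
qed

instantiation ranked :: (finite) wellorder
begin

definition less_eq_ranked :: "'a ranked \<Rightarrow> 'a ranked \<Rightarrow> bool" where
  "x \<le> y \<longleftrightarrow> to_nat_on UNIV (Rep_ranked x) \<le> to_nat_on UNIV (Rep_ranked y)"

definition less_ranked :: "'a ranked \<Rightarrow> 'a ranked \<Rightarrow> bool" where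
  "x < y \<longleftrightarrow> to_nat_on UNIV (Rep_ranked x) < to_nat_on UNIV (Rep_ranked y)"

instance
proof
  fix x y :: "'a ranked"
  assume "x \<le> y" "y \<le> x"
  then have "to_nat_on UNIV (Rep_ranked x) = to_nat_on UNIV (Rep_ranked y)"
    by (simp add: less_eq_ranked_def)
  then have "Rep_ranked x = Rep_ranked y"
    by (rule inj_onD[OF inj_on_to_nat_on[OF countable_finite[OF finite]]]) auto
  then show "x = y" by (simp only: Rep_ranked_inject)
next
  fix P and a :: "'a ranked"
  assume step: "\<And>x :: 'a ranked. (\<And>y. y < x \<Longrightarrow> P y) \<Longrightarrow> P x"
  show "P a"
  proof (induction a rule: measure_induct_rule[of "\<lambda>x. to_nat_on UNIV (Rep_ranked x)"])
    case (less x)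
    show ?case by (rule step, rule less) (simp only: less_ranked_def)
  qed
qed (auto simp: less_eq_ranked_def less_ranked_def)

end

definition to_ranked :: "real^'n \<Rightarrow> real^'n ranked" where
  "to_ranked x = (\<chi> i. x $ Rep_ranked i)"

definition of_ranked :: "real^'n ranked \<Rightarrow> real^'n" where
  "of_ranked x = (\<chi> i. x $ Abs_ranked i)"

lemma of_ranked_to_ranked [simp]: "of_ranked (to_ranked x) = x"
  and to_ranked_of_ranked [simp]: "to_ranked (of_ranked y) = y"
  by (simp_all add: to_ranked_def of_ranked_def vec_eq_iff Abs_ranked_inverse Rep_ranked_inverse)

lemma linear_to_ranked: "linear to_ranked"
  and linear_of_ranked: "linear of_ranked"
  by (auto intro!: linearI simp: to_ranked_def of_ranked_def vec_eq_iff)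

lemma bij_Rep_ranked: "bij Rep_ranked"
  by (rule bij_betw_byWitness[where f' = Abs_ranked]) (auto simp: Abs_ranked_inverse Rep_ranked_inverse)

lemma inner_to_ranked: "to_ranked x \<bullet> to_ranked y = x \<bullet> y"
  using sum.reindex_bij_betw[OF bij_Rep_ranked, of "\<lambda>i. x $ i * y $ i"]
  by (simp add: inner_vec_def to_ranked_def)

lemma card_ranked: "CARD('n ranked) = CARD('n)"
  using bij_betw_same_card[OF bij_Rep_ranked] by simp

lemma prod_Basis_cart: "(\<Prod>b\<in>Basis. (x :: real^'n) \<bullet> b) = (\<Prod>i\<in>UNIV. x $ i)"
proof -
  have "bij_betw (\<lambda>i. axis i 1) UNIV (Basis :: (real^'n) set)"
    by (auto simp: bij_betw_def Basis_vec_def inj_on_def axis_eq_axis)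
  from prod.reindex_bij_betw[OF this, of "\<lambda>b. x \<bullet> b"] show ?thesis by (simp add: inner_axis)
qed

lemma volume_to_ranked:
  fixes K :: "(real^'n) set"
  assumes "compact K"
  shows "volume (to_ranked ` K) = volume K"
proof -
  have meas: "(to_ranked :: real^'n \<Rightarrow> _) \<in> borel_measurable lborel"
    by (simp add: borel_measurable_continuous_onI linear_continuous_on linear_linear linear_to_ranked)
  have "(lborel :: (real^'n ranked) measure) = distr lborel borel to_ranked"
  proof (rule lborel_eqI)
    fix l u :: "real^'n ranked" assume lu: "\<And>b. b \<in> Basis \<Longrightarrow> l \<bullet> b \<le> u \<bullet> b"
    have le: "l $ i \<le> u $ i" for i using lu[of "axis i 1"] by (auto simp: Basis_vec_def inner_axis)
    have "to_ranked -` box l u = box (of_ranked l) (of_ranked u)"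
      by (auto simp: mem_box_cart to_ranked_def of_ranked_def Rep_ranked_inverse)
         (metis Abs_ranked_inverse UNIV_I Rep_ranked_inverse)+
    moreover have "of_ranked l \<bullet> b \<le> of_ranked u \<bullet> b" if "b \<in> Basis" for b
      using that le by (auto simp: Basis_vec_def inner_axis of_ranked_def)
    moreover have "(\<Prod>b\<in>Basis. (of_ranked u - of_ranked l) \<bullet> b) = (\<Prod>b\<in>Basis. (u - l) \<bullet> b)"
      using prod.reindex_bij_betw[OF bij_Rep_ranked, of "\<lambda>i. (of_ranked u - of_ranked l) $ i"]
      unfolding prod_Basis_cart by (simp add: of_ranked_def Rep_ranked_inverse)
    ultimately show "emeasure (distr lborel borel to_ranked) (box l u) = (\<Prod>b\<in>Basis. (u - l) \<bullet> b)"
      using meas by (subst emeasure_distr) auto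
  qed simp
  then have "measure lborel (to_ranked ` K) = measure (distr lborel borel to_ranked) (to_ranked ` K)"
    by simp
  also have "\<dots> = measure lborel (to_ranked -` (to_ranked ` K))"
    using meas assms by (subst measure_distr)
      (auto intro!: borel_compact compact_continuous_image linear_continuous_on simp: linear_linear linear_to_ranked)
  also have "to_ranked -` (to_ranked ` K) = K"
    by (auto simp: image_iff) (metis of_ranked_to_ranked)
  moreover have "to_ranked ` K \<in> sets lborel"
    using assms by (auto intro!: borel_compact compact_continuous_image linear_continuous_on simp: linear_linear linear_to_ranked)
  moreover have "K \<in> sets lborel" using assms by (simp add: borel_compact)
  ultimately show ?thesis by simp
qed

lemma volume_orthogonal_image:
  fixes A :: "real^'n \<Rightarrow> real^'n"
  assumes A: "orthogonal_transformation A" and "compact K"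
  shows "volume (A ` K) = volume K"
proof -
  define B where "B = to_ranked \<circ> A \<circ> of_ranked"
  have "of_ranked x \<bullet> of_ranked y = x \<bullet> y" for x y :: "real^'n ranked"
    using inner_to_ranked[of "of_ranked x" "of_ranked y"] by simp
  then have "orthogonal_transformation B"
    using A linear_to_ranked linear_of_ranked unfolding orthogonal_transformation_def B_def
    by (auto intro!: linear_compose simp: inner_to_ranked)
  moreover have cK: "compact (to_ranked ` K)"
    using assms(2) by (auto intro!: compact_continuous_image linear_continuous_on simp: linear_linear linear_to_ranked)
  ultimately have "volume (B ` to_ranked ` K) = volume (to_ranked ` K)"
    by (intro measure_orthogonal_image lmeasurable_compact)
  moreover have "B ` to_ranked ` K = to_ranked ` A ` K"
    by (simp add: image_image B_def)
  moreover have "compact (A ` K)"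
    using A assms(2) by (auto intro!: compact_continuous_image linear_continuous_on simp: linear_linear orthogonal_transformation_linear)
  ultimately show ?thesis using assms(2) by (simp add: volume_to_ranked)
qed

lemma volume_sum_hull_polarized:
  fixes V :: "nat \<Rightarrow> (real^'n::{finite,wellorder}) set"
  assumes V: "\<And>i. i < m \<Longrightarrow> finite (V i)" "\<And>i. i < m \<Longrightarrow> V i \<noteq> {}"
    and l: "\<And>i. i < m \<Longrightarrow> 0 \<le> l i"
  shows "volume (\<Sum>i<m. (*\<^sub>R) (l i) ` (convex hull V i)) =
    (\<Sum>is | length is = CARD('n) \<and> set is \<subseteq> {..<m}.
       polarization CARD('n) (\<lambda>S. volume (\<Sum>j\<in>S. convex hull V (is ! j))) * prod_list (map l is))"
    (is "_ = ?rhs")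
proof -
  let ?L = "{is. length is = CARD('n) \<and> set is \<subseteq> {..<m}}"
  have fin: "finite ?L" using finite_lists_length_eq[of "{..<m}"] by (simp add: conj_commute)
  have 1: "((\<lambda>x. det (\<Sum>j\<in>S. lse_hess (V (is ! j)) x)) has_integral volume (\<Sum>j\<in>S. convex hull V (is ! j))) UNIV"
    if "is \<in> ?L" "S \<in> Pow {..<CARD('n)}" for "is" S
  proof -
    have "finite S" using that finite_subset by auto
    moreover have "is ! j < m" if "j \<in> S" for j
    proof -
      have "j < length is" using that \<open>is \<in> ?L\<close> \<open>S \<in> _\<close> by auto
      then show ?thesis using \<open>is \<in> ?L\<close> nth_mem by blast
    qed
    ultimately show ?thesis
      using has_integral_det_sum_lse_hess[of S "\<lambda>j. V (is ! j)" "\<lambda>_. 1"] V by (simp add: image_def)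
  qed
  have "((\<lambda>x. \<Sum>is\<in>?L. polarization CARD('n) (\<lambda>S. det (\<Sum>j\<in>S. lse_hess (V (is ! j)) x)) * prod_list (map l is))
      has_integral ?rhs) UNIV"
    unfolding polarization_def
    by (intro has_integral_sum[OF fin] has_integral_mult_left has_integral_divide has_integral_sum
        has_integral_mult_right 1) auto
  then have "((\<lambda>x. det (\<Sum>i<m. l i *\<^sub>R lse_hess (V i) x)) has_integral ?rhs) UNIV"
    by (simp only: det_sum_polarized)
  moreover have "((\<lambda>x. det (\<Sum>i<m. l i *\<^sub>R lse_hess (V i) x)) has_integral
      volume (\<Sum>i<m. (*\<^sub>R) (l i) ` (convex hull V i))) UNIV"
    by (rule has_integral_det_sum_lse_hess) (use V l in auto)
  ultimately show ?thesis by (rule has_integral_unique[rotated])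
qed

definition exhausts :: "(nat \<Rightarrow> 'a::euclidean_space set) \<Rightarrow> 'a set \<Rightarrow> bool" where
  "exhausts V K \<longleftrightarrow> incseq V \<and> (\<forall>k. finite (V k) \<and> V k \<noteq> {} \<and> V k \<subseteq> K) \<and> K \<subseteq> closure (\<Union>k. V k)"

lemma exhausts_exists:
  fixes K :: "'a::euclidean_space set"
  assumes "K \<noteq> {}"
  obtains V where "exhausts V K"
proof -
  obtain D where D: "countable D" "D \<subseteq> K" "K \<subseteq> closure D" by (rule separable)
  then have "D \<noteq> {}" using assms by auto
  have "(\<Union>k. from_nat_into D ` {..k}) = range (from_nat_into D)" by auto
  then have "(\<Union>k. from_nat_into D ` {..k}) = D"
    using D(1) \<open>D \<noteq> {}\<close> by (simp add: range_from_nat_into)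
  then have "exhausts (\<lambda>k. from_nat_into D ` {..k}) K"
    using D from_nat_into[OF \<open>D \<noteq> {}\<close>]
    by (auto simp: exhausts_def incseq_def intro!: image_mono)
  then show ?thesis by (rule that)
qed

lemma tendsto_volume_sum_hull:
  fixes K :: "'i \<Rightarrow> 'a::euclidean_space set"
  assumes I: "finite I" and K: "\<And>i. i \<in> I \<Longrightarrow> K i \<in> conv_bodies"
    and V: "\<And>i. i \<in> I \<Longrightarrow> exhausts (V i) (K i)"
  shows "(\<lambda>k. volume (\<Sum>i\<in>I. (*\<^sub>R) (l i) ` (convex hull V i k)))
    \<longlonglongrightarrow> volume (\<Sum>i\<in>I. (*\<^sub>R) (l i) ` K i)"
proof -
  define P where "P k = (\<Sum>i\<in>I. (*\<^sub>R) (l i) ` (convex hull V i k))" for k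
  define Q where "Q = (\<Sum>i\<in>I. (*\<^sub>R) (l i) ` K i)"
  note Vd = V[unfolded exhausts_def]
  have P: "P k \<in> conv_bodies" for k unfolding P_def
    using Vd by (intro conv_bodies_sum conv_bodies_scaleR conv_bodiesI) (auto simp: finite_imp_compact_convex_hull)
  have Q: "Q \<in> conv_bodies" unfolding Q_def using K by (intro conv_bodies_sum conv_bodies_scaleR) auto
  have mono: "incseq P"
  proof (rule incseq_SucI, rule subsetI)
    fix k x assume "x \<in> P k"
    then obtain s where s: "\<forall>i\<in>I. s i \<in> convex hull V i k" "x = (\<Sum>i\<in>I. l i *\<^sub>R s i)"
      unfolding P_def mem_sum_scaleR_image_iff[OF I] by blast
    have "convex hull V i k \<subseteq> convex hull V i (Suc k)" if "i \<in> I" for i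
      using Vd[OF that] by (intro hull_mono) (auto simp: incseq_SucD)
    then show "x \<in> P (Suc k)"
      unfolding P_def mem_sum_scaleR_image_iff[OF I] using s by (intro exI[of _ s]) auto
  qed
  have PQ: "P k \<subseteq> Q" for k
  proof
    fix x assume "x \<in> P k"
    then obtain s where s: "\<forall>i\<in>I. s i \<in> convex hull V i k" "x = (\<Sum>i\<in>I. l i *\<^sub>R s i)"
      unfolding P_def mem_sum_scaleR_image_iff[OF I] by blast
    have "convex hull V i k \<subseteq> K i" if "i \<in> I" for i
      using Vd[OF that] conv_bodiesD(2)[OF K[OF that]] by (intro hull_minimal) auto
    then show "x \<in> Q"
      unfolding Q_def mem_sum_scaleR_image_iff[OF I] using s by (intro exI[of _ s]) auto
  qed
  define U where "U = (\<Union>k. P k)"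
  have "U \<subseteq> Q" using PQ by (auto simp: U_def)
  have "convex U"
  proof (rule convexI)
    fix x y :: 'a and a b :: real
    assume "x \<in> U" "y \<in> U" and ab: "0 \<le> a" "0 \<le> b" "a + b = 1"
    then obtain j k where "x \<in> P j" "y \<in> P k" by (auto simp: U_def)
    then have "x \<in> P (max j k)" "y \<in> P (max j k)"
      using mono by (meson incseq_def max.cobounded1 max.cobounded2 subsetD)+
    then have "a *\<^sub>R x + b *\<^sub>R y \<in> P (max j k)"
      using conv_bodiesD(2)[OF P] ab by (meson convexD)
    then show "a *\<^sub>R x + b *\<^sub>R y \<in> U" by (auto simp: U_def)
  qed
  have "Q \<subseteq> closure U"
  proof
    fix x assume "x \<in> Q"
    then obtain s where s: "\<forall>i\<in>I. s i \<in> K i" "x = (\<Sum>i\<in>I. l i *\<^sub>R s i)"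
      unfolding Q_def mem_sum_scaleR_image_iff[OF I] by blast
    have "\<forall>i\<in>I. \<exists>y. (\<forall>n. y n \<in> (\<Union>k. V i k)) \<and> y \<longlonglongrightarrow> s i"
      using s Vd closure_sequential by (metis (no_types, lifting) subsetD)
    then obtain y where y: "\<And>i n. i \<in> I \<Longrightarrow> y i n \<in> (\<Union>k. V i k)" "\<And>i. i \<in> I \<Longrightarrow> y i \<longlonglongrightarrow> s i"
      by metis
    have "(\<Sum>i\<in>I. l i *\<^sub>R y i n) \<in> U" for n
    proof -
      have "\<forall>i\<in>I. \<exists>k. y i n \<in> V i k" using y(1) by blast
      then obtain k where k: "\<And>i. i \<in> I \<Longrightarrow> y i n \<in> V i (k i)" by metis
      define k' where "k' = Max (insert 0 (k ` I))"
      have "k i \<le> k'" if "i \<in> I" for i using that I by (simp add: k'_def)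
      then have "y i n \<in> convex hull V i k'" if "i \<in> I" for i
        using k[OF that] Vd[OF that] that by (meson hull_inc incseq_def subsetD)
      then have "(\<Sum>i\<in>I. l i *\<^sub>R y i n) \<in> P k'"
        unfolding P_def mem_sum_scaleR_image_iff[OF I] by (intro exI[of _ "\<lambda>i. y i n"]) auto
      then show ?thesis by (auto simp: U_def)
    qed
    moreover have "(\<lambda>n. \<Sum>i\<in>I. l i *\<^sub>R y i n) \<longlonglongrightarrow> x"
      unfolding s(2) using y(2) by (intro tendsto_intros) auto
    ultimately show "x \<in> closure U" unfolding closure_sequential by (intro exI[of _ "\<lambda>n. \<Sum>i\<in>I. l i *\<^sub>R y i n"]) auto
  qed
  then have "closure U = Q"
    using \<open>U \<subseteq> Q\<close> conv_bodiesD(3)[OF Q] by (meson closure_minimal compact_imp_closed subset_antisym)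
  then have "interior Q \<subseteq> U"
    using convex_interior_closure[OF \<open>convex U\<close>] interior_subset by metis
  then have "(Q - U) \<union> (U - Q) \<subseteq> frontier Q"
    using \<open>U \<subseteq> Q\<close> closure_subset by (auto simp: frontier_def)
  then have "negligible ((Q - U) \<union> (U - Q))"
    using negligible_convex_frontier conv_bodiesD(2)[OF Q] negligible_subset by blast
  note neg = lmeasurable_negligible_symdiff[OF conv_bodies_lmeasurable[OF Q] this]
    measure_negligible_symdiff[OF conv_bodies_lmeasurable[OF Q] this]
  have "(\<lambda>k. volume (P k)) \<longlonglongrightarrow> volume (\<Union>k. P k)"
    using conv_bodies_lmeasurable[OF P] mono neg(1)[unfolded U_def]
    by (intro Lim_measure_incseq) (auto simp: fmeasurable_def)
  then show ?thesis using neg(2) by (simp add: U_def P_def[abs_def] Q_def)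
qed

lemma volume_sum_polarized_wellorder:
  fixes K :: "nat \<Rightarrow> (real^'n::{finite,wellorder}) set"
  assumes K: "\<And>i. i < m \<Longrightarrow> K i \<in> conv_bodies" and l: "\<And>i. i < m \<Longrightarrow> 0 \<le> l i"
  shows "volume (\<Sum>i<m. (*\<^sub>R) (l i) ` K i) =
    (\<Sum>is | length is = CARD('n) \<and> set is \<subseteq> {..<m}.
       polarization CARD('n) (\<lambda>S. volume (\<Sum>j\<in>S. K (is ! j))) * prod_list (map l is))"
proof -
  let ?L = "{is. length is = CARD('n) \<and> set is \<subseteq> {..<m}}"
  have "\<forall>i. \<exists>V. i < m \<longrightarrow> exhausts V (K i)"
    using K conv_bodiesD(1) exhausts_exists by metis
  then obtain V where V: "\<And>i. i < m \<Longrightarrow> exhausts (V i) (K i)" by metis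
  have "(\<lambda>k. volume (\<Sum>j\<in>S. convex hull V (is ! j) k)) \<longlonglongrightarrow> volume (\<Sum>j\<in>S. K (is ! j))"
    if "is \<in> ?L" "S \<subseteq> {..<CARD('n)}" for "is" S
  proof -
    have "finite S" using that finite_subset by auto
    moreover have "is ! j < m" if "j \<in> S" for j
    proof -
      have "j < length is" using that \<open>is \<in> ?L\<close> \<open>S \<subseteq> _\<close> by auto
      then show ?thesis using \<open>is \<in> ?L\<close> nth_mem by blast
    qed
    ultimately show ?thesis
      using tendsto_volume_sum_hull[of S "\<lambda>j. K (is ! j)" "\<lambda>j. V (is ! j)" "\<lambda>_. 1"] V K
      by (simp add: image_def)
  qed
  then have "(\<lambda>k. \<Sum>is\<in>?L. polarization CARD('n) (\<lambda>S. volume (\<Sum>j\<in>S. convex hull V (is ! j) k)) * prod_list (map l is))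
      \<longlonglongrightarrow> (\<Sum>is\<in>?L. polarization CARD('n) (\<lambda>S. volume (\<Sum>j\<in>S. K (is ! j))) * prod_list (map l is))"
    by (intro tendsto_intros tendsto_polarization) auto
  moreover have "volume (\<Sum>i<m. (*\<^sub>R) (l i) ` (convex hull V i k)) =
     (\<Sum>is\<in>?L. polarization CARD('n) (\<lambda>S. volume (\<Sum>j\<in>S. convex hull V (is ! j) k)) * prod_list (map l is))" for k
    by (rule volume_sum_hull_polarized) (use V l in \<open>auto simp: exhausts_def\<close>)
  moreover have "(\<lambda>k. volume (\<Sum>i<m. (*\<^sub>R) (l i) ` (convex hull V i k))) \<longlonglongrightarrow> volume (\<Sum>i<m. (*\<^sub>R) (l i) ` K i)"
    by (rule tendsto_volume_sum_hull) (use K V in auto)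
  ultimately show ?thesis using LIMSEQ_unique by auto
qed

theorem volume_sum_polarized:
  fixes K :: "nat \<Rightarrow> (real^'n) set"
  assumes K: "\<And>i. i < m \<Longrightarrow> K i \<in> conv_bodies" and l: "\<And>i. i < m \<Longrightarrow> 0 \<le> l i"
  shows "volume (\<Sum>i<m. (*\<^sub>R) (l i) ` K i) =
    (\<Sum>is | length is = CARD('n) \<and> set is \<subseteq> {..<m}.
       polarization CARD('n) (\<lambda>S. volume (\<Sum>j\<in>S. K (is ! j))) * prod_list (map l is))"
proof -
  let ?T = "to_ranked :: real^'n \<Rightarrow> _"
  let ?L = "{is. length is = CARD('n) \<and> set is \<subseteq> {..<m}}"
  have T: "(*\<^sub>R) c ` ?T ` L = ?T ` (*\<^sub>R) c ` L" for c L
    by (simp add: image_image linear_cmul[OF linear_to_ranked])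
  have vol: "volume (\<Sum>j\<in>S. ?T ` L j) = volume (\<Sum>j\<in>S. L j)"
    if "\<And>j. j \<in> S \<Longrightarrow> L j \<in> conv_bodies" for S and L :: "nat \<Rightarrow> (real^'n) set"
    using that conv_bodiesD(3)[OF conv_bodies_sum, of S L]
    by (simp add: volume_to_ranked flip: linear_image_set_sum[OF linear_to_ranked])
  have lt: "is ! j < m" if "is \<in> ?L" "S \<subseteq> {..<CARD('n)}" "j \<in> S" for "is" S j
  proof -
    have "j < length is" using that by auto
    then show ?thesis using \<open>is \<in> ?L\<close> nth_mem by blast
  qed
  have "volume (\<Sum>i<m. (*\<^sub>R) (l i) ` K i) = volume (\<Sum>i<m. ?T ` (*\<^sub>R) (l i) ` K i)"
    by (rule vol[symmetric]) (use K in \<open>auto intro: conv_bodies_scaleR\<close>)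
  also have "\<dots> = volume (\<Sum>i<m. (*\<^sub>R) (l i) ` ?T ` K i)" by (simp only: T)
  also have "\<dots> = (\<Sum>is\<in>?L. polarization CARD('n) (\<lambda>S. volume (\<Sum>j\<in>S. ?T ` K (is ! j))) * prod_list (map l is))"
    using volume_sum_polarized_wellorder[of m "\<lambda>i. ?T ` K i" l] K l
    by (simp add: card_ranked conv_bodies_linear_image linear_to_ranked)
  also have "\<dots> = (\<Sum>is\<in>?L. polarization CARD('n) (\<lambda>S. volume (\<Sum>j\<in>S. K (is ! j))) * prod_list (map l is))"
  proof (rule sum.cong[OF refl])
    fix "is" assume "is \<in> ?L"
    then have "polarization CARD('n) (\<lambda>S. volume (\<Sum>j\<in>S. ?T ` K (is ! j))) =
        polarization CARD('n) (\<lambda>S. volume (\<Sum>j\<in>S. K (is ! j)))"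
      using lt K by (intro polarization_cong vol) blast
    then show "polarization CARD('n) (\<lambda>S. volume (\<Sum>j\<in>S. ?T ` K (is ! j))) * prod_list (map l is) =
        polarization CARD('n) (\<lambda>S. volume (\<Sum>j\<in>S. K (is ! j))) * prod_list (map l is)" by simp
  qed
  finally show ?thesis .
qed

section \<open>Mixed volumes along an orbit\<close>

lemma minkowski_coeffs_unique:
  fixes Ks :: "'a::euclidean_space set list"
  assumes c: "minkowski_coeffs Ks c" and len: "length Ks = DIM('a)" and ne: "{} \<notin> set Ks"
  shows "c [0..<DIM('a)] = polarization DIM('a) (\<lambda>S. volume (\<Sum>j\<in>S. Ks ! j))"
proof -
  let ?n = "DIM('a)"
  define G where "G = {is. length is = ?n \<and> set is \<subseteq> {..<?n}}"
  have fin: "finite G" using finite_lists_length_eq[of "{..<?n}"] by (simp add: G_def conj_commute)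
  have pol: "polarization ?n (\<lambda>S. volume (\<Sum>j\<in>S. Ks ! j)) = (\<Sum>is\<in>{is \<in> G. set is = {..<?n}}. c is) / fact ?n"
  proof (rule polarization_sum[OF fin])
    fix S assume S: "S \<subseteq> {..<?n}"
    have "(\<Sum>j\<in>S. Ks ! j) = (\<Sum>i<?n. if i \<in> S then Ks ! i else 0)"
      using S by (simp add: sum.inter_restrict[symmetric] Int_absorb1)
    also have "\<dots> = (\<Sum>i<?n. (*\<^sub>R) (if i \<in> S then 1 else 0) ` (Ks ! i))"
    proof (rule sum.cong[OF refl])
      fix i assume "i \<in> {..<?n}"
      then have "Ks ! i \<noteq> {}" using ne len by (metis lessThan_iff nth_mem)
      then show "(if i \<in> S then Ks ! i else 0) = (*\<^sub>R) (if i \<in> S then 1 else 0) ` (Ks ! i)"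
        by (cases "i \<in> S") (simp_all add: image_constant_conv)
    qed
    finally have "volume (\<Sum>j\<in>S. Ks ! j) = (\<Sum>is\<in>G. c is * prod_list (map (\<lambda>i. if i \<in> S then 1 else 0) is))"
      using conjunct2[OF c[unfolded minkowski_coeffs_def], rule_format, of "\<lambda>i. if i \<in> S then 1 else 0"]
      by (simp only: len G_def) simp
    also have "\<dots> = (\<Sum>is\<in>G. if set is \<subseteq> S then c is else 0)"
    proof (rule sum.cong[OF refl])
      fix "is"
      have "prod_list (map (\<lambda>i. if i \<in> S then 1 else 0) is) = (if set is \<subseteq> S then 1 else 0 :: real)"
        by (induction "is") auto
      then show "c is * prod_list (map (\<lambda>i. if i \<in> S then 1 else 0) is) = (if set is \<subseteq> S then c is else 0)"
        by simp
    qed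
    finally show "volume (\<Sum>j\<in>S. Ks ! j) = \<dots>" .
  qed (auto simp: G_def)
  have perms: "{is \<in> G. set is = {..<?n}} = permutations_of_set {..<?n}"
  proof -
    have "length is = ?n \<longleftrightarrow> distinct is" if "set is = {..<?n}" for "is"
      using card_distinct[of "is"] distinct_card[of "is"] that by (metis card_lessThan)
    then show ?thesis unfolding G_def permutations_of_set_def by blast
  qed
  have const: "(\<Sum>is\<in>permutations_of_set {..<?n}. c is) = (\<Sum>is\<in>permutations_of_set {..<?n}. c [0..<?n])"
  proof (rule sum.cong[OF refl])
    fix "is" assume "is \<in> permutations_of_set {..<?n}"
    then have "mset is = mset [0..<?n]"
      by (subst set_eq_iff_mset_eq_distinct[symmetric]) (simp_all add: permutations_of_set_def atLeast0LessThan)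
    then show "c is = c [0..<?n]"
      by (rule conjunct1[OF c[unfolded minkowski_coeffs_def], rule_format])
  qed
  show ?thesis unfolding pol perms const by simp
qed

lemma minkowski_coeffs_exists:
  fixes Ks :: "(real^'n) set list"
  assumes K: "set Ks \<subseteq> conv_bodies"
  shows "\<exists>c. minkowski_coeffs Ks c"
proof -
  define P where "P is = polarization CARD('n) (\<lambda>S. volume (\<Sum>j\<in>S. Ks ! (is ! j)))" for "is"
  define c where "c is = (if length is = CARD('n) then P is else 0)" for "is"
  have "c is = c js" if eq: "mset is = mset js" for "is" js
  proof (cases "length js = CARD('n)")
    case True
    obtain p where p: "p permutes {..<length js}" "permute_list p js = is"
      using mset_eq_permutation[OF eq] by blast
    have "P is = polarization CARD('n) (\<lambda>S. volume (\<Sum>j\<in>p ` S. Ks ! (js ! j)))"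
      unfolding P_def
    proof (rule polarization_cong)
      fix S assume "S \<subseteq> {..<CARD('n)}"
      moreover have "inj p" using p(1) permutes_inj by blast
      ultimately have "(\<Sum>j\<in>p ` S. Ks ! (js ! j)) = (\<Sum>j\<in>S. Ks ! (is ! j))"
        using p True by (auto simp: sum.reindex inj_on_subset permute_list_nth intro!: sum.cong)
      then show "volume (\<Sum>j\<in>S. Ks ! (is ! j)) = volume (\<Sum>j\<in>p ` S. Ks ! (js ! j))" by simp
    qed
    also have "\<dots> = P js" unfolding P_def
      using polarization_permute[of p "CARD('n)" "\<lambda>S. volume (\<Sum>j\<in>S. Ks ! (js ! j))"] p True by simp
    finally show ?thesis using True mset_eq_length[OF eq] by (simp add: c_def)
  qed (use mset_eq_length[OF eq] in \<open>simp add: c_def\<close>)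
  moreover have "volume (\<Sum>i<length Ks. (*\<^sub>R) (l i) ` (Ks ! i)) =
      (\<Sum>is | length is = DIM(real^'n) \<and> set is \<subseteq> {..<length Ks}. c is * prod_list (map l is))"
    if "\<forall>i<length Ks. 0 \<le> l i" for l
    using volume_sum_polarized[of "length Ks" "(!) Ks" l] that K nth_mem
    by (subst volume_sum_polarized) (auto simp: c_def P_def intro!: sum.cong)
  ultimately show ?thesis unfolding minkowski_coeffs_def by blast
qed

theorem mixed_volume_eq_polarization:
  fixes Ks :: "(real^'n) set list"
  assumes K: "set Ks \<subseteq> conv_bodies" and len: "length Ks = CARD('n)"
  shows "mixed_volume Ks = polarization CARD('n) (\<lambda>S. volume (\<Sum>j\<in>S. Ks ! j))"
proof -
  have "{} \<notin> set Ks" using K conv_bodiesD(1) by auto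
  note unique = minkowski_coeffs_unique[OF _ _ this]
  obtain c where c: "minkowski_coeffs Ks c" using minkowski_coeffs_exists[OF K] by blast
  show ?thesis unfolding mixed_volume_def
  proof (rule the_equality)
    show "\<exists>c. minkowski_coeffs Ks c \<and> polarization CARD('n) (\<lambda>S. volume (\<Sum>j\<in>S. Ks ! j)) = c [0..<DIM(real^'n)]"
      using unique[OF c] len c by (intro exI[of _ c]) simp
  qed (use unique len in auto)
qed

lemma sum_prod_list_eq_power:
  fixes w :: "'i \<Rightarrow> 'b::comm_semiring_1"
  assumes "finite I"
  shows "(\<Sum>is | length is = n \<and> set is \<subseteq> I. prod_list (map w is)) = (\<Sum>i\<in>I. w i) ^ n"
proof (induction n)
  case 0
  have "{is. length is = 0 \<and> set is \<subseteq> I} = {[]}" by auto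
  then show ?case by simp
next
  case (Suc n)
  let ?L = "{is. length is = n \<and> set is \<subseteq> I}"
  have "bij_betw (\<lambda>(i, is). i # is) (I \<times> ?L) {is. length is = Suc n \<and> set is \<subseteq> I}"
    by (rule bij_betw_byWitness[where f' = "\<lambda>is. (hd is, tl is)"]) (auto simp: length_Suc_conv)
  from sum.reindex_bij_betw[OF this, of "\<lambda>is. prod_list (map w is)"]
  have "(\<Sum>is | length is = Suc n \<and> set is \<subseteq> I. prod_list (map w is)) =
      (\<Sum>(i, is)\<in>I \<times> ?L. w i * prod_list (map w is))"
    by (simp add: case_prod_unfold)
  also have "\<dots> = (\<Sum>i\<in>I. w i) * (\<Sum>is\<in>?L. prod_list (map w is))"
    by (simp add: sum_product sum.cartesian_product)
  finally show ?case by (simp add: Suc)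
qed

lemma orthogonal_transformation_funpow:
  fixes A :: "'a::euclidean_space \<Rightarrow> 'a"
  shows "orthogonal_transformation A \<Longrightarrow> orthogonal_transformation (A ^^ k)"
  by (induction k) (auto simp: orthogonal_transformation_def linear_id linear_compose)

lemma mixed_volume_orbit_le_sup:
  fixes A :: "real^'n \<Rightarrow> real^'n"
  assumes A: "orthogonal_transformation A" and X0: "X0 \<in> conv_bodies" and ks: "length ks = CARD('n) - 1"
  shows "mixed_volume (map (\<lambda>k. (A ^^ k) ` X0) ks @ [X0]) \<le> orbit_mixed_volume_sup A X0"
proof -
  note orth = orthogonal_transformation_funpow[OF A]
  note lin = orthogonal_transformation_linear[OF orth]
  obtain r where r: "\<And>x. x \<in> X0 \<Longrightarrow> norm x \<le> r" "0 \<le> r"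
    using compact_imp_bounded[OF conv_bodiesD(3)[OF X0]] unfolding bounded_iff
    by (metis all_not_in_conv conv_bodiesD(1)[OF X0] norm_ge_zero order_trans)
  define C where "C = (\<Sum>S\<in>Pow {..<CARD('n)}. volume (cball (0::real^'n) (card S * r))) / fact CARD('n)"
  have "mixed_volume (map (\<lambda>k. (A ^^ k) ` X0) ks @ [X0]) \<le> C" if len: "length ks = CARD('n) - 1" for ks
  proof -
    let ?Ks = "map (\<lambda>k. (A ^^ k) ` X0) ks @ [X0]"
    have Ks: "set ?Ks \<subseteq> conv_bodies" using X0 lin by (auto intro!: conv_bodies_linear_image)
    have lenK: "length ?Ks = CARD('n)" using len by simp
    have small: "norm x \<le> r" if "x \<in> K" "K \<in> set ?Ks" for x K
      using that r orthogonal_transformation_norm[OF orth] by auto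
    have "(-1) ^ (CARD('n) - card S) * volume (\<Sum>j\<in>S. ?Ks ! j) \<le> volume (cball (0::real^'n) (card S * r))"
      if "S \<in> Pow {..<CARD('n)}" for S
    proof -
      have "finite S" using that finite_subset by auto
      have mem: "?Ks ! j \<in> set ?Ks" if "j \<in> S" for j
        using that \<open>S \<in> _\<close> lenK by (intro nth_mem) auto
      have "(\<Sum>j\<in>S. ?Ks ! j) \<subseteq> cball 0 (card S * r)"
      proof
        fix x assume "x \<in> (\<Sum>j\<in>S. ?Ks ! j)"
        then obtain s where s: "\<forall>j\<in>S. s j \<in> ?Ks ! j" "x = sum s S"
          unfolding set_sum_alt[OF \<open>finite S\<close>] by blast
        have "norm x \<le> (\<Sum>j\<in>S. norm (s j))" unfolding s(2) by (rule norm_sum)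
        also have "\<dots> \<le> card S * r" using s(1) mem small by (intro sum_bounded_above) blast
        finally show "x \<in> cball 0 (card S * r)" by simp
      qed
      moreover have "(\<Sum>j\<in>S. ?Ks ! j) \<in> conv_bodies" using mem Ks by (intro conv_bodies_sum) blast
      ultimately have "volume (\<Sum>j\<in>S. ?Ks ! j) \<le> volume (cball (0::real^'n) (card S * r))"
        by (intro measure_mono_fmeasurable) (auto dest: conv_bodies_lmeasurable)
      moreover have "(-1) ^ m * v \<le> v" if "0 \<le> v" for m and v :: real
        using that by (cases "even m") auto
      ultimately show ?thesis by (meson measure_nonneg order_trans)
    qed
    then show ?thesis
      unfolding mixed_volume_eq_polarization[OF Ks lenK] C_def polarization_def
      by (intro divide_right_mono sum_mono) auto
  qed
  then have "bdd_above ((\<lambda>ks. mixed_volume (map (\<lambda>k. (A ^^ k) ` X0) ks @ [X0])) ` {ks. length ks = CARD('n) - 1})"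
    by (auto intro!: bdd_aboveI)
  then show ?thesis unfolding orbit_mixed_volume_sup_def
    using ks by (intro cSUP_upper) auto
qed

lemma polarization_orbit_le_sup:
  fixes A :: "real^'n \<Rightarrow> real^'n"
  assumes A: "orthogonal_transformation A" and X0: "X0 \<in> conv_bodies" and len: "length is = CARD('n)"
  shows "polarization CARD('n) (\<lambda>S. volume (\<Sum>j\<in>S. (A ^^ (is ! j)) ` X0)) \<le> orbit_mixed_volume_sup A X0"
proof -
  let ?n = "CARD('n)"
  note orth = orthogonal_transformation_funpow[OF A]
  note lin = orthogonal_transformation_linear[OF orth]
  have n: "0 < ?n" by simp
  define m where "m = Min (set is)"
  have "set is \<noteq> {}" using len n by auto
  then have "m \<in> set is" and le: "\<And>k. k \<in> set is \<Longrightarrow> m \<le> k" by (simp_all add: m_def)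
  then obtain j0 where j0: "j0 < ?n" "is ! j0 = m" using len by (auto simp: in_set_conv_nth)
  define p where "p = Transposition.transpose j0 (?n - 1)"
  have p: "p permutes {..<?n}" using j0 n unfolding p_def by (intro permutes_swap_id) auto
  then have inj: "inj p" by (rule permutes_inj)
  have p_lt: "p j < ?n" if "j < ?n" for j using permutes_in_image[OF p, of j] that by simp
  define ks where "ks = map (\<lambda>j. is ! p j - m) [0..<?n - 1]"
  define Ks where "Ks = map (\<lambda>k. (A ^^ k) ` X0) ks @ [X0]"
  have Ks: "set Ks \<subseteq> conv_bodies" "length Ks = ?n"
    using X0 lin by (auto simp: Ks_def ks_def intro!: conv_bodies_linear_image)
  have nth: "(A ^^ m) ` (Ks ! j) = (A ^^ (is ! p j)) ` X0" if "j < ?n" for j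
  proof (cases "j = ?n - 1")
    case True
    then have "Ks ! j = X0" by (simp add: Ks_def ks_def nth_append)
    moreover have "is ! p j = m" using True j0 by (simp add: p_def)
    ultimately show ?thesis by simp
  next
    case False
    then have "j < ?n - 1" using that by simp
    then have "Ks ! j = (A ^^ (is ! p j - m)) ` X0" by (simp add: Ks_def ks_def nth_append)
    moreover have "m \<le> is ! p j" using le p_lt[OF that] len by simp
    ultimately show ?thesis by (simp add: image_comp flip: funpow_add)
  qed
  have "polarization ?n (\<lambda>S. volume (\<Sum>j\<in>S. (A ^^ (is ! j)) ` X0)) =
      polarization ?n (\<lambda>S. volume (\<Sum>j\<in>p ` S. (A ^^ (is ! j)) ` X0))"
    using polarization_permute[OF p, of "\<lambda>S. volume (\<Sum>j\<in>S. (A ^^ (is ! j)) ` X0)"] by simp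
  also have "\<dots> = polarization ?n (\<lambda>S. volume (\<Sum>j\<in>S. Ks ! j))"
  proof (rule polarization_cong)
    fix S assume S: "S \<subseteq> {..<?n}"
    have "(\<Sum>j\<in>p ` S. (A ^^ (is ! j)) ` X0) = (\<Sum>j\<in>S. (A ^^ m) ` (Ks ! j))"
    proof (subst sum.reindex)
      show "(\<Sum>j\<in>S. ((\<lambda>j. (A ^^ (is ! j)) ` X0) \<circ> p) j) = (\<Sum>j\<in>S. (A ^^ m) ` (Ks ! j))"
        using S by (intro sum.cong) (simp_all add: nth subset_iff)
    qed (rule inj_on_subset[OF inj], simp)
    also have "\<dots> = (A ^^ m) ` (\<Sum>j\<in>S. Ks ! j)"
      by (rule linear_image_set_sum[OF lin, symmetric])
    also have "volume \<dots> = volume (\<Sum>j\<in>S. Ks ! j)"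
    proof (rule volume_orthogonal_image[OF orth])
      have "Ks ! j \<in> conv_bodies" if "j \<in> S" for j
      proof -
        have "j < length Ks" using that S Ks(2) by auto
        then show ?thesis using Ks(1) nth_mem by blast
      qed
      then show "compact (\<Sum>j\<in>S. Ks ! j)" by (intro conv_bodiesD(3) conv_bodies_sum)
    qed
    finally show "volume (\<Sum>j\<in>p ` S. (A ^^ (is ! j)) ` X0) = volume (\<Sum>j\<in>S. Ks ! j)" .
  qed
  also have "\<dots> = mixed_volume Ks" by (rule mixed_volume_eq_polarization[OF Ks, symmetric])
  also have "\<dots> \<le> orbit_mixed_volume_sup A X0"
    unfolding Ks_def by (rule mixed_volume_orbit_le_sup[OF A X0]) (simp add: ks_def)
  finally show ?thesis .
qed

lemma volume_orbit_sum_le: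
  fixes A :: "real^'n \<Rightarrow> real^'n"
  assumes A: "orthogonal_transformation A" and X0: "X0 \<in> conv_bodies" and w: "\<And>k. 0 \<le> w k"
  shows "volume (\<Sum>k<N. (*\<^sub>R) (w k) ` (A ^^ k) ` X0) \<le> orbit_mixed_volume_sup A X0 * (\<Sum>k<N. w k) ^ CARD('n)"
proof -
  let ?L = "{is. length is = CARD('n) \<and> set is \<subseteq> {..<N}}"
  note lin = orthogonal_transformation_linear[OF orthogonal_transformation_funpow[OF A]]
  have "volume (\<Sum>k<N. (*\<^sub>R) (w k) ` (A ^^ k) ` X0) = (\<Sum>is\<in>?L.
      polarization CARD('n) (\<lambda>S. volume (\<Sum>j\<in>S. (A ^^ (is ! j)) ` X0)) * prod_list (map w is))"
    using w X0 lin by (intro volume_sum_polarized conv_bodies_linear_image)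
  also have "\<dots> \<le> (\<Sum>is\<in>?L. orbit_mixed_volume_sup A X0 * prod_list (map w is))"
    using w by (intro sum_mono mult_right_mono polarization_orbit_le_sup[OF A X0] prod_list_nonneg) auto
  also have "\<dots> = orbit_mixed_volume_sup A X0 * (\<Sum>k<N. w k) ^ CARD('n)"
    by (simp add: sum_prod_list_eq_power flip: sum_distrib_left)
  finally show ?thesis .
qed

section \<open>The Brunn-Minkowski inequality\<close>

lemma prod_root_sum_le:
  fixes p q :: "'i \<Rightarrow> real"
  assumes I: "finite I" "I \<noteq> {}" and p: "\<And>i. i \<in> I \<Longrightarrow> 0 < p i" and q: "\<And>i. i \<in> I \<Longrightarrow> 0 < q i"
  shows "(root (card I) (\<Prod>i\<in>I. p i) + root (card I) (\<Prod>i\<in>I. q i)) ^ card I \<le> (\<Prod>i\<in>I. p i + q i)"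
proof -
  let ?n = "card I"
  have n: "0 < ?n" using I by (simp add: card_gt_0_iff)
  have am_gm: "root ?n (\<Prod>i\<in>I. x i / (p i + q i)) \<le> (\<Sum>i\<in>I. x i / (p i + q i) / ?n)"
    if "\<And>i. i \<in> I \<Longrightarrow> 0 < x i" for x
  proof -
    have nn: "0 \<le> x i / (p i + q i)" if "i \<in> I" for i
      using \<open>\<And>i. i \<in> I \<Longrightarrow> 0 < x i\<close>[OF that] p[OF that] q[OF that] by simp
    then show ?thesis
      using arith_geom_mean[OF I nn] n by (simp add: root_powr_inverse prod_nonneg)
  qed
  have pos: "0 < (\<Prod>i\<in>I. p i + q i)" using p q by (intro prod_pos) (simp add: add_pos_pos)
  have "root ?n (\<Prod>i\<in>I. p i) + root ?n (\<Prod>i\<in>I. q i) =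
      (root ?n (\<Prod>i\<in>I. p i / (p i + q i)) + root ?n (\<Prod>i\<in>I. q i / (p i + q i))) * root ?n (\<Prod>i\<in>I. p i + q i)"
    using pos n by (simp add: prod_dividef real_root_divide field_simps)
  also have "\<dots> \<le> ((\<Sum>i\<in>I. p i / (p i + q i) / ?n) + (\<Sum>i\<in>I. q i / (p i + q i) / ?n)) * root ?n (\<Prod>i\<in>I. p i + q i)"
    using pos by (intro mult_right_mono add_mono am_gm p q real_root_ge_zero) auto
  also have "(\<Sum>i\<in>I. p i / (p i + q i) / ?n) + (\<Sum>i\<in>I. q i / (p i + q i) / ?n) = (\<Sum>i\<in>I. 1 / ?n)"
    unfolding sum.distrib[symmetric]
  proof (rule sum.cong[OF refl])
    fix i assume "i \<in> I"
    then have "p i + q i \<noteq> 0" using p q by (metis add_pos_pos less_irrefl)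
    then show "p i / (p i + q i) / ?n + q i / (p i + q i) / ?n = 1 / ?n"
      by (metis add_divide_distrib divide_self)
  qed
  also have "\<dots> = 1" using n by simp
  finally have "root ?n (\<Prod>i\<in>I. p i) + root ?n (\<Prod>i\<in>I. q i) \<le> root ?n (\<Prod>i\<in>I. p i + q i)" by simp
  then have "(root ?n (\<Prod>i\<in>I. p i) + root ?n (\<Prod>i\<in>I. q i)) ^ ?n \<le> root ?n (\<Prod>i\<in>I. p i + q i) ^ ?n"
    using p q by (intro power_mono add_nonneg_nonneg real_root_ge_zero prod_nonneg) (auto intro: less_imp_le)
  then show ?thesis using pos n by simp
qed

lemma cbox_add_subset:
  fixes a b c d :: "'a::euclidean_space"
  assumes "box a b \<noteq> {}" "box c d \<noteq> {}"
  shows "cbox (a + c) (b + d) \<subseteq> cbox a b + cbox c d"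
proof
  fix x assume x: "x \<in> cbox (a + c) (b + d)"
  define p where "p j = (b - a) \<bullet> j" for j
  define q where "q j = (d - c) \<bullet> j" for j
  have pos: "0 < p j" "0 < q j" if "j \<in> Basis" for j
    using assms that by (auto simp: box_ne_empty p_def q_def inner_diff_left)
  define s where "s j = (x - a - c) \<bullet> j / (p j + q j)" for j
  have s: "0 \<le> s j" "s j \<le> 1" if "j \<in> Basis" for j
    using x that pos[OF that] by (auto simp: mem_box s_def p_def q_def inner_diff_left inner_add_left field_simps)
  define y where "y = (\<Sum>j\<in>Basis. (a \<bullet> j + s j * p j) *\<^sub>R j)"
  have yj: "y \<bullet> j = a \<bullet> j + s j * p j" if "j \<in> Basis" for j using that by (simp add: y_def)
  have xj: "x \<bullet> j = a \<bullet> j + c \<bullet> j + s j * p j + s j * q j" if "j \<in> Basis" for j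
  proof -
    have "s j * (p j + q j) = (x - a - c) \<bullet> j" using pos[OF that] by (simp add: s_def)
    then show ?thesis by (simp add: inner_diff_left algebra_simps)
  qed
  have "s j * p j \<le> p j" "s j * q j \<le> q j" "0 \<le> s j * p j" "0 \<le> s j * q j" if "j \<in> Basis" for j
    using s[OF that] pos[OF that] by (auto intro: mult_left_le_one_le)
  then have "y \<in> cbox a b" "x - y \<in> cbox c d"
    by (auto simp: mem_box yj xj inner_diff_left p_def q_def algebra_simps)
  then have "y + (x - y) \<in> cbox a b + cbox c d" by (rule set_plus_intro)
  then show "x \<in> cbox a b + cbox c d" by simp
qed

lemma volume_cbox_add:
  fixes a b c d :: "'a::euclidean_space"
  assumes "box a b \<noteq> {}" "box c d \<noteq> {}"
  shows "(root DIM('a) (volume (cbox a b)) + root DIM('a) (volume (cbox c d))) ^ DIM('a)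
    \<le> volume (cbox a b + cbox c d)"
proof -
  have pos: "0 < (b - a) \<bullet> j" "0 < (d - c) \<bullet> j" if "j \<in> Basis" for j
    using assms that by (auto simp: box_ne_empty inner_diff_left)
  then have le: "a \<bullet> j \<le> b \<bullet> j" "c \<bullet> j \<le> d \<bullet> j" if "j \<in> Basis" for j
    using that by (auto simp: inner_diff_left intro: less_imp_le)
  have "(root DIM('a) (volume (cbox a b)) + root DIM('a) (volume (cbox c d))) ^ DIM('a)
      \<le> (\<Prod>j\<in>Basis. (b - a) \<bullet> j + (d - c) \<bullet> j)"
    using prod_root_sum_le[of Basis "\<lambda>j. (b - a) \<bullet> j" "\<lambda>j. (d - c) \<bullet> j"] pos le
    by (simp add: measure_lborel_cbox_eq)
  also have "\<dots> = volume (cbox (a + c) (b + d))"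
    using le by (simp add: measure_lborel_cbox_eq inner_add_left inner_diff_left add_mono algebra_simps)
  also have "\<dots> \<le> volume (cbox a b + cbox c d)"
    using cbox_add_subset[OF assms]
    by (intro measure_mono_fmeasurable lmeasurable_compact compact_set_plus) auto
  finally show ?thesis .
qed

definition box_family :: "'a::euclidean_space set set \<Rightarrow> bool" where
  "box_family D \<longleftrightarrow> finite D \<and> (\<forall>k\<in>D. interior k \<noteq> {} \<and> (\<exists>a b. k = cbox a b)) \<and>
     pairwise (\<lambda>j k. interior j \<inter> interior k = {}) D"

lemma box_family_compact: "box_family D \<Longrightarrow> compact (\<Union>D)"
  by (auto simp: box_family_def intro!: compact_Union)

lemma box_family_volume_pos:
  assumes "box_family D" "D \<noteq> {}"
  shows "0 < volume (\<Union>D)"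
proof -
  obtain k where k: "k \<in> D" "interior k \<noteq> {}" "k \<subseteq> \<Union>D"
    using assms by (auto simp: box_family_def)
  then have "\<not> negligible (\<Union>D)"
    by (meson interior_subset negligible_subset open_interior open_not_negligible)
  then show ?thesis
    using box_family_compact[OF assms(1)]
    by (auto simp: negligible_iff_measure lmeasurable_compact less_le)
qed

lemma box_family_of_boxes:
  assumes fin: "finite D" and box: "\<And>k. k \<in> D \<Longrightarrow> \<exists>a b. k = cbox a b"
    and disj: "pairwise (\<lambda>j k. interior j \<inter> interior k = {}) D"
  shows "box_family {k \<in> D. interior k \<noteq> {}}"
    and "volume (\<Union>{k \<in> D. interior k \<noteq> {}}) = volume (\<Union>D)"
proof -
  show "box_family {k \<in> D. interior k \<noteq> {}}"
    unfolding box_family_def using assms by (auto intro: pairwise_subset)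
  have "negligible (\<Union>{k \<in> D. interior k = {}})"
  proof (rule negligible_Union)
    fix k assume "k \<in> {k \<in> D. interior k = {}}"
    then obtain a b where "k = cbox a b" "interior k = {}" using box by blast
    then show "negligible k" using negligible_convex_interior[of k] by (simp add: convex_box)
  qed (use fin in simp)
  then have "negligible (\<Union>D - \<Union>{k \<in> D. interior k \<noteq> {}} \<union> (\<Union>{k \<in> D. interior k \<noteq> {}} - \<Union>D))"
    by (rule negligible_subset) auto
  moreover have "compact (\<Union>D)" using fin by (intro compact_Union) (auto dest!: box)
  ultimately show "volume (\<Union>{k \<in> D. interior k \<noteq> {}}) = volume (\<Union>D)"
    by (intro measure_negligible_symdiff lmeasurable_compact)
qed

lemma box_family_restrict:
  assumes D: "box_family D" and H: "\<And>a b. \<exists>c d. cbox a b \<inter> H = cbox c d"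
  obtains D' where "box_family D'" "\<Union>D' \<subseteq> \<Union>D \<inter> H" "volume (\<Union>D') = volume (\<Union>D \<inter> H)"
    "card D' \<le> card {k \<in> D. interior (k \<inter> H) \<noteq> {}}"
proof -
  define E where "E = (\<lambda>k. k \<inter> H) ` D"
  have fin: "finite E" using D by (simp add: E_def box_family_def)
  moreover have "\<exists>a b. k = cbox a b" if "k \<in> E" for k
    using that D H by (auto simp: E_def box_family_def)
  moreover have "pairwise (\<lambda>j k. interior j \<inter> interior k = {}) E"
  proof (rule pairwiseI)
    fix j k assume "j \<in> E" "k \<in> E" "j \<noteq> k"
    then obtain j' k' where "j' \<in> D" "k' \<in> D" "j' \<noteq> k'" "j = j' \<inter> H" "k = k' \<inter> H"
      by (auto simp: E_def)
    then have "interior j' \<inter> interior k' = {}"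
      using D[unfolded box_family_def, THEN conjunct2, THEN conjunct2] by (simp add: pairwise_def)
    then show "interior j \<inter> interior k = {}"
      using \<open>j = _\<close> \<open>k = _\<close> by auto
  qed
  ultimately have *: "box_family {k \<in> E. interior k \<noteq> {}}"
      "volume (\<Union>{k \<in> E. interior k \<noteq> {}}) = volume (\<Union>E)"
    by (rule box_family_of_boxes; simp)+
  have "\<Union>E = \<Union>D \<inter> H" by (auto simp: E_def)
  moreover have "{k \<in> E. interior k \<noteq> {}} = (\<lambda>k. k \<inter> H) ` {k \<in> D. interior (k \<inter> H) \<noteq> {}}"
    unfolding E_def by blast
  then have "card {k \<in> E. interior k \<noteq> {}} \<le> card {k \<in> D. interior (k \<inter> H) \<noteq> {}}"
  proof -
    have "finite {k \<in> D. interior (k \<inter> H) \<noteq> {}}" using D by (simp add: box_family_def)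
    from card_image_le[OF this, of "\<lambda>k. k \<inter> H"] show ?thesis by (simp only: \<open>{k \<in> E. _ k} = _\<close>)
  qed
  moreover have "\<Union>{k \<in> E. interior k \<noteq> {}} \<subseteq> \<Union>E" by auto
  ultimately show ?thesis using * by (intro that[of "{k \<in> E. interior k \<noteq> {}}"]) simp_all
qed

lemma cbox_Int_halfspace:
  fixes i :: "'a::euclidean_space"
  assumes "i \<in> Basis"
  shows "\<exists>c' d'. cbox a b \<inter> {x. x \<bullet> i \<le> c} = cbox c' d'" "\<exists>c' d'. cbox a b \<inter> {x. c \<le> x \<bullet> i} = cbox c' d'"
  using interval_split[OF assms] by blast+

lemma volume_halfspace_split:
  fixes S :: "'a::euclidean_space set"
  assumes S: "compact S" and i: "i \<in> Basis"
  shows "volume S = volume (S \<inter> {x. x \<bullet> i \<le> c}) + volume (S \<inter> {x. c \<le> x \<bullet> i})"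
proof -
  have closed: "closed {x. x \<bullet> i \<le> c}" "closed {x. c \<le> x \<bullet> i}"
    using closed_halfspace_le[where a = i and b = c] closed_halfspace_ge[where a = i and b = c] by (auto simp: inner_commute)
  then have meas: "S \<inter> {x. x \<bullet> i \<le> c} \<in> lmeasurable" "S \<inter> {x. c \<le> x \<bullet> i} \<in> lmeasurable"
    using S by (auto intro!: lmeasurable_compact compact_Int_closed)
  have "negligible ((S \<inter> {x. x \<bullet> i \<le> c}) \<inter> (S \<inter> {x. c \<le> x \<bullet> i}))"
    by (rule negligible_subset[OF negligible_standard_hyperplane[OF i, of c]]) auto
  then have "volume ((S \<inter> {x. x \<bullet> i \<le> c}) \<inter> (S \<inter> {x. c \<le> x \<bullet> i})) = 0"
    by (rule negligible_imp_measure0)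
  moreover have "(S \<inter> {x. x \<bullet> i \<le> c}) \<union> (S \<inter> {x. c \<le> x \<bullet> i}) = S" by auto
  ultimately show ?thesis using measure_Un3[OF meas] by simp
qed

lemma volume_halfspace_IVT:
  fixes S :: "'a::euclidean_space set"
  assumes S: "compact S" and i: "i \<in> Basis" and v: "0 \<le> v" "v \<le> volume S"
  obtains c where "volume (S \<inter> {x. x \<bullet> i \<le> c}) = v"
proof -
  obtain a b where ab: "S \<subseteq> cbox a b" using bounded_subset_cbox_symmetric[OF compact_imp_bounded[OF S]] by blast
  define L where "L = (\<Prod>j\<in>Basis - {i}. \<bar>(b - a) \<bullet> j\<bar>)"
  define g where "g c = volume (S \<inter> {x. x \<bullet> i \<le> c})" for c
  have L: "0 \<le> L" by (simp add: L_def prod_nonneg)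
  have meas: "S \<inter> {x. x \<bullet> i \<le> c} \<in> lmeasurable" for c
    using S closed_halfspace_le[where a = i and b = c] by (auto simp: inner_commute intro!: lmeasurable_compact compact_Int_closed)
  have mono: "g c \<le> g c'" if "c \<le> c'" for c c'
    unfolding g_def using that meas by (intro measure_mono_fmeasurable) auto
  have lip: "g c' \<le> g c + L * (c' - c)" if "c \<le> c'" for c c'
  proof -
    define a' where "a' = a + (c - a \<bullet> i) *\<^sub>R i"
    define b' where "b' = b + (c' - b \<bullet> i) *\<^sub>R i"
    have aj: "a' \<bullet> j = (if j = i then c else a \<bullet> j)" and bj: "b' \<bullet> j = (if j = i then c' else b \<bullet> j)"
      if "j \<in> Basis" for j
      using that i by (auto simp: a'_def b'_def inner_add_left inner_Basis)
    have "volume (cbox a' b') \<le> (\<Prod>j\<in>Basis. \<bar>(b' - a') \<bullet> j\<bar>)"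
      by (auto simp: measure_lborel_cbox_eq prod_nonneg inner_diff_left intro!: prod_mono)
    also have "\<dots> = \<bar>(b' - a') \<bullet> i\<bar> * (\<Prod>j\<in>Basis - {i}. \<bar>(b' - a') \<bullet> j\<bar>)"
      using i by (intro prod.remove) auto
    also have "(\<Prod>j\<in>Basis - {i}. \<bar>(b' - a') \<bullet> j\<bar>) = L"
      unfolding L_def by (intro prod.cong) (auto simp: inner_diff_left aj bj)
    also have "\<bar>(b' - a') \<bullet> i\<bar> = c' - c" using that i by (simp add: inner_diff_left aj bj)
    finally have vol: "volume (cbox a' b') \<le> L * (c' - c)" by (simp add: mult.commute)
    have "S \<inter> {x. x \<bullet> i \<le> c'} \<subseteq> (S \<inter> {x. x \<bullet> i \<le> c}) \<union> cbox a' b'"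
      using ab by (auto simp: mem_box aj bj subset_iff)
    then have "g c' \<le> measure lebesgue ((S \<inter> {x. x \<bullet> i \<le> c}) \<union> cbox a' b')"
      unfolding g_def using meas by (intro measure_mono_fmeasurable fmeasurable.Un) auto
    also have "\<dots> \<le> g c + volume (cbox a' b')"
      unfolding g_def using meas by (intro measure_Un_le) auto
    finally show ?thesis using vol by simp
  qed
  have "\<bar>g c - g c'\<bar> \<le> L * \<bar>c - c'\<bar>" for c c'
    using lip[of c c'] lip[of c' c] mono[of c c'] mono[of c' c] by (cases "c \<le> c'") auto
  then have "L-lipschitz_on {a \<bullet> i - 1..max (a \<bullet> i) (b \<bullet> i)} g" using L by (auto intro!: lipschitz_onI simp: dist_real_def)
  then have cont: "continuous_on {a \<bullet> i - 1..max (a \<bullet> i) (b \<bullet> i)} g" by (rule lipschitz_on_continuous_on)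
  have "S \<inter> {x. x \<bullet> i \<le> a \<bullet> i - 1} = {}" using ab i by (force simp: mem_box)
  moreover have "S \<inter> {x. x \<bullet> i \<le> max (a \<bullet> i) (b \<bullet> i)} = S" using ab i by (fastforce simp: mem_box)
  ultimately have "g (a \<bullet> i - 1) \<le> v" "v \<le> g (max (a \<bullet> i) (b \<bullet> i))" using v by (simp_all add: g_def)
  then obtain c where "g c = v" using IVT'[OF _ _ _ cont] by force
  then show ?thesis using that by (simp add: g_def)
qed

lemma box_family_separate:
  fixes D :: "'a::euclidean_space set set"
  assumes D: "box_family D" and "2 \<le> card D"
  obtains i c j k where "i \<in> Basis" "j \<in> D" "k \<in> D" "j \<subseteq> {x. x \<bullet> i \<le> c}" "k \<subseteq> {x. c \<le> x \<bullet> i}"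
proof -
  obtain j k where jk: "j \<in> D" "k \<in> D" "j \<noteq> k"
    using card_le_Suc0_iff_eq[of D] assms by (auto simp: box_family_def)
  then obtain a b c d where ab: "j = cbox a b" "k = cbox c d" using D by (metis box_family_def)
  have "box a b \<noteq> {}" "box c d \<noteq> {}" "box a b \<inter> box c d = {}"
    using D jk ab unfolding box_family_def pairwise_def by (metis interior_cbox)+
  then obtain i where i: "i \<in> Basis" "b \<bullet> i \<le> c \<bullet> i \<or> d \<bullet> i \<le> a \<bullet> i"
    by (auto simp: disjoint_interval box_ne_empty)
  from i(2) show ?thesis
  proof
    assume "b \<bullet> i \<le> c \<bullet> i"
    then show ?thesis using i(1) jk ab by (intro that[of i j k "b \<bullet> i"]) (force simp: mem_box)+
  next
    assume "d \<bullet> i \<le> a \<bullet> i"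
    then show ?thesis using i(1) jk ab by (intro that[of i k j "d \<bullet> i"]) (force simp: mem_box)+
  qed
qed

lemma interior_hyperplane_empty:
  fixes i :: "'a::euclidean_space"
  assumes "i \<in> Basis" "S \<subseteq> {x. x \<bullet> i = c}"
  shows "interior S = {}"
proof -
  have "negligible (interior S)"
    using negligible_subset[OF negligible_standard_hyperplane[OF assms(1)] order_trans[OF interior_subset assms(2)]] .
  then show ?thesis using open_not_negligible by blast
qed

text \<open>Cut \<open>D\<close> by a hyperplane that separates two of its boxes, and \<open>E\<close> by a parallel hyperplane in the
  same volume ratio \<open>\<alpha> : 1 - \<alpha>\<close>: the sums of the corresponding halves do not overlap.\<close>

lemma brunn_minkowski_boxes_step:
  fixes D E :: "'a::euclidean_space set set"
  defines "n \<equiv> DIM('a)"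
  assumes D: "box_family D" "2 \<le> card D" and E: "box_family E" "E \<noteq> {}"
    and IH: "\<And>D' E' :: 'a set set. box_family D' \<Longrightarrow> box_family E' \<Longrightarrow> D' \<noteq> {} \<Longrightarrow> E' \<noteq> {} \<Longrightarrow>
      card D' < card D \<Longrightarrow> card E' \<le> card E \<Longrightarrow>
      (root n (volume (\<Union>D')) + root n (volume (\<Union>E'))) ^ n \<le> volume (\<Union>D' + \<Union>E')"
  shows "(root n (volume (\<Union>D)) + root n (volume (\<Union>E))) ^ n \<le> volume (\<Union>D + \<Union>E)"
proof -
  have n: "0 < n" by (simp add: n_def)
  have "D \<noteq> {}" using D(2) by auto
  obtain i c j k where i: "i \<in> Basis" and jk: "j \<in> D" "k \<in> D" "j \<subseteq> {x. x \<bullet> i \<le> c}" "k \<subseteq> {x. c \<le> x \<bullet> i}"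
    by (rule box_family_separate[OF D]) (rule that)
  obtain D1 where D1: "box_family D1" "\<Union>D1 \<subseteq> \<Union>D \<inter> {x. x \<bullet> i \<le> c}"
    "volume (\<Union>D1) = volume (\<Union>D \<inter> {x. x \<bullet> i \<le> c})" "card D1 \<le> card {k \<in> D. interior (k \<inter> {x. x \<bullet> i \<le> c}) \<noteq> {}}"
    by (rule box_family_restrict[OF D(1) cbox_Int_halfspace(1)[OF i]]) (rule that)
  obtain D2 where D2: "box_family D2" "\<Union>D2 \<subseteq> \<Union>D \<inter> {x. c \<le> x \<bullet> i}"
    "volume (\<Union>D2) = volume (\<Union>D \<inter> {x. c \<le> x \<bullet> i})" "card D2 \<le> card {k \<in> D. interior (k \<inter> {x. c \<le> x \<bullet> i}) \<noteq> {}}"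
    by (rule box_family_restrict[OF D(1) cbox_Int_halfspace(2)[OF i]]) (rule that)
  have cD: "compact (\<Union>D)" "compact (\<Union>E)" using D(1) E(1) by (auto intro: box_family_compact)
  have closed: "closed {x. x \<bullet> i \<le> c}" "closed {x. c \<le> x \<bullet> i}" for c
    using closed_halfspace_le[where a = i and b = c] closed_halfspace_ge[where a = i and b = c] by (auto simp: inner_commute)
  have int: "interior j \<noteq> {}" "interior k \<noteq> {}" using D(1) jk by (auto simp: box_family_def)
  have "j \<subseteq> \<Union>D \<inter> {x. x \<bullet> i \<le> c}" "k \<subseteq> \<Union>D \<inter> {x. c \<le> x \<bullet> i}" using jk by auto
  then have "\<not> negligible (\<Union>D \<inter> {x. x \<bullet> i \<le> c})" "\<not> negligible (\<Union>D \<inter> {x. c \<le> x \<bullet> i})"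
    using int by (meson interior_subset negligible_subset open_interior open_not_negligible)+
  then have pos: "0 < volume (\<Union>D1)" "0 < volume (\<Union>D2)"
    using D1(3) D2(3) cD closed
    by (metis lmeasurable_compact compact_Int_closed measure_nonneg negligible_iff_measure order_le_less)+
  have sum: "volume (\<Union>D) = volume (\<Union>D1) + volume (\<Union>D2)"
    unfolding D1(3) D2(3) by (rule volume_halfspace_split[OF cD(1) i])
  have "interior (k \<inter> {x. x \<bullet> i \<le> c}) = {}" "interior (j \<inter> {x. c \<le> x \<bullet> i}) = {}"
    by (rule interior_hyperplane_empty[OF i, where c = c], use jk in force)+
  then have "{k \<in> D. interior (k \<inter> {x. x \<bullet> i \<le> c}) \<noteq> {}} \<subset> D" "{k \<in> D. interior (k \<inter> {x. c \<le> x \<bullet> i}) \<noteq> {}} \<subset> D"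
    using jk by blast+
  then have card1: "card D1 < card D" "card D2 < card D"
    using D1(4) D2(4) D(1) psubset_card_mono[of D] unfolding box_family_def by (meson le_less_trans)+
  define \<alpha> where "\<alpha> = volume (\<Union>D1) / volume (\<Union>D)"
  have \<alpha>: "0 < \<alpha>" "\<alpha> < 1" using pos sum by (auto simp: \<alpha>_def field_simps)
  have D12: "volume (\<Union>D1) = \<alpha> * volume (\<Union>D)" "volume (\<Union>D2) = (1 - \<alpha>) * volume (\<Union>D)"
    using pos sum by (auto simp: \<alpha>_def field_simps)
  have Epos: "0 < volume (\<Union>E)" using box_family_volume_pos[OF E] .
  obtain e where e: "volume (\<Union>E \<inter> {x. x \<bullet> i \<le> e}) = \<alpha> * volume (\<Union>E)"
    using volume_halfspace_IVT[OF cD(2) i, of "\<alpha> * volume (\<Union>E)"] \<alpha> Epos by auto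
  then have e2: "volume (\<Union>E \<inter> {x. e \<le> x \<bullet> i}) = (1 - \<alpha>) * volume (\<Union>E)"
    using volume_halfspace_split[OF cD(2) i, of e] by (simp add: algebra_simps)
  obtain E1 where E1: "box_family E1" "\<Union>E1 \<subseteq> \<Union>E \<inter> {x. x \<bullet> i \<le> e}"
    "volume (\<Union>E1) = volume (\<Union>E \<inter> {x. x \<bullet> i \<le> e})" "card E1 \<le> card {k \<in> E. interior (k \<inter> {x. x \<bullet> i \<le> e}) \<noteq> {}}"
    by (rule box_family_restrict[OF E(1) cbox_Int_halfspace(1)[OF i]]) (rule that)
  obtain E2 where E2: "box_family E2" "\<Union>E2 \<subseteq> \<Union>E \<inter> {x. e \<le> x \<bullet> i}"
    "volume (\<Union>E2) = volume (\<Union>E \<inter> {x. e \<le> x \<bullet> i})" "card E2 \<le> card {k \<in> E. interior (k \<inter> {x. e \<le> x \<bullet> i}) \<noteq> {}}"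
    by (rule box_family_restrict[OF E(1) cbox_Int_halfspace(2)[OF i]]) (rule that)
  have finE: "finite E" using E(1) by (simp add: box_family_def)
  have card2: "card E1 \<le> card E" "card E2 \<le> card E"
    by (rule order_trans[OF E1(4)] order_trans[OF E2(4)], rule card_mono[OF finE], blast)+
  have vE: "volume (\<Union>E1) = \<alpha> * volume (\<Union>E)" "volume (\<Union>E2) = (1 - \<alpha>) * volume (\<Union>E)"
    using E1(3) E2(3) e e2 by auto
  have "0 < \<alpha> * volume (\<Union>E)" "0 < (1 - \<alpha>) * volume (\<Union>E)" using \<alpha> Epos by simp_all
  then have ne: "D1 \<noteq> {}" "D2 \<noteq> {}" "E1 \<noteq> {}" "E2 \<noteq> {}" using pos vE by auto
  let ?r = "root n (volume (\<Union>D)) + root n (volume (\<Union>E))"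
  have scale: "(root n (\<beta> * volume (\<Union>D)) + root n (\<beta> * volume (\<Union>E))) ^ n = \<beta> * ?r ^ n" if "0 \<le> \<beta>" for \<beta>
    using that n by (simp add: real_root_mult power_mult_distrib flip: distrib_left)
  have "?r ^ n = \<alpha> * ?r ^ n + (1 - \<alpha>) * ?r ^ n" by (simp add: algebra_simps)
  also have "\<dots> \<le> volume (\<Union>D1 + \<Union>E1) + volume (\<Union>D2 + \<Union>E2)"
    using IH[OF D1(1) E1(1) ne(1,3) card1(1) card2(1)] IH[OF D2(1) E2(1) ne(2,4) card1(2) card2(2)]
      scale[of \<alpha>] scale[of "1 - \<alpha>"] \<alpha> by (simp add: D12 vE)
  also have "\<dots> \<le> volume ((\<Union>D + \<Union>E) \<inter> {x. x \<bullet> i \<le> c + e}) + volume ((\<Union>D + \<Union>E) \<inter> {x. c + e \<le> x \<bullet> i})"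
  proof (rule add_mono)
    have "\<Union>D1 + \<Union>E1 \<subseteq> (\<Union>D + \<Union>E) \<inter> {x. x \<bullet> i \<le> c + e}"
      using D1(2) E1(2) by (force elim!: set_plus_elim simp: inner_add_left)
    then show "volume (\<Union>D1 + \<Union>E1) \<le> volume ((\<Union>D + \<Union>E) \<inter> {x. x \<bullet> i \<le> c + e})"
      using cD closed box_family_compact[OF D1(1)] box_family_compact[OF E1(1)]
      by (intro measure_mono_fmeasurable) (auto intro!: lmeasurable_compact compact_Int_closed compact_set_plus fmeasurableD)
    have "\<Union>D2 + \<Union>E2 \<subseteq> (\<Union>D + \<Union>E) \<inter> {x. c + e \<le> x \<bullet> i}"
      using D2(2) E2(2) by (force elim!: set_plus_elim simp: inner_add_left)
    then show "volume (\<Union>D2 + \<Union>E2) \<le> volume ((\<Union>D + \<Union>E) \<inter> {x. c + e \<le> x \<bullet> i})"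
      using cD closed box_family_compact[OF D2(1)] box_family_compact[OF E2(1)]
      by (intro measure_mono_fmeasurable) (auto intro!: lmeasurable_compact compact_Int_closed compact_set_plus fmeasurableD)
  qed
  also have "\<dots> = volume (\<Union>D + \<Union>E)"
    using volume_halfspace_split[OF compact_set_plus[OF cD] i] by simp
  finally show ?thesis .
qed

lemma brunn_minkowski_boxes:
  fixes D E :: "'a::euclidean_space set set"
  assumes "box_family D" "D \<noteq> {}" "box_family E" "E \<noteq> {}"
  shows "(root DIM('a) (volume (\<Union>D)) + root DIM('a) (volume (\<Union>E))) ^ DIM('a) \<le> volume (\<Union>D + \<Union>E)"
  using assms
proof (induction "card D + card E" arbitrary: D E rule: less_induct)
  case less
  have fin: "finite D" "finite E" using less.prems by (auto simp: box_family_def)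
  show ?case
  proof (cases "2 \<le> card D")
    case True
    show ?thesis
      by (rule brunn_minkowski_boxes_step[OF less.prems(1) True less.prems(3,4)]) (rule less.hyps; simp)
  next
    case D1: False
    show ?thesis
    proof (cases "2 \<le> card E")
      case True
      have "(root DIM('a) (volume (\<Union>E)) + root DIM('a) (volume (\<Union>D))) ^ DIM('a) \<le> volume (\<Union>E + \<Union>D)"
        by (rule brunn_minkowski_boxes_step[OF less.prems(3) True less.prems(1,2)]) (rule less.hyps; simp)
      then show ?thesis by (simp add: add.commute)
    next
      case False
      have "card D \<noteq> 0" "card E \<noteq> 0" using fin less.prems by auto
      then have "card D = 1" "card E = 1" using D1 False by linarith+
      then obtain j k where jk: "D = {j}" "E = {k}" by (metis card_1_singletonE)
      have "interior j \<noteq> {}" "\<exists>a b. j = cbox a b" "interior k \<noteq> {}" "\<exists>a b. k = cbox a b"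
        using less.prems(1,3) by (simp_all add: jk box_family_def)
      then obtain a b c d where "j = cbox a b" "k = cbox c d" "interior j \<noteq> {}" "interior k \<noteq> {}"
        by (elim exE) (rule that)
      then show ?thesis using volume_cbox_add[of a b c d] jk by simp
    qed
  qed
qed

lemma inner_box_families:
  fixes K :: "'a::euclidean_space set"
  assumes K: "convex K" "compact K"
  obtains D where "\<And>k::nat. box_family (D k)" "\<And>k. \<Union>(D k) \<subseteq> K" "(\<lambda>k. volume (\<Union>(D k))) \<longlonglongrightarrow> volume K"
proof -
  obtain \<D> where \<D>: "countable \<D>" "\<D> \<subseteq> Pow (interior K)" "\<And>X. X \<in> \<D> \<Longrightarrow> \<exists>a b. X = cbox a b" "\<Union>\<D> = interior K"
    by (rule open_countable_Union_open_cbox[OF open_interior]) (rule that)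
  define \<D>' where "\<D>' = insert {} \<D>"
  have \<D>': "countable \<D>'" "\<D>' \<noteq> {}" "\<Union>\<D>' = interior K" "\<And>X. X \<in> \<D>' \<Longrightarrow> \<exists>a b. X = cbox a b"
    using \<D> by (auto simp: \<D>'_def) (metis empty_as_interval)
  define C where "C = from_nat_into \<D>'"
  have C: "C j \<in> \<D>'" for j unfolding C_def by (rule from_nat_into[OF \<D>'(2)])
  have C_range: "range C = \<D>'" unfolding C_def by (rule range_from_nat_into[OF \<D>'(2,1)])
  have "\<exists>p. p division_of (\<Union>(C ` {..k}))" for k
    using elementary_unions_intervals[of "C ` {..k}"] C \<D>'(4) by (metis finite_atMost finite_imageI imageE)
  then obtain p where p: "\<And>k. p k division_of (\<Union>(C ` {..k}))" by metis
  define D where "D k = {j \<in> p k. interior j \<noteq> {}}" for k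
  have fam: "box_family (D k)" "volume (\<Union>(D k)) = volume (\<Union>(C ` {..k}))" for k
  proof -
    have *: "finite (p k)" "\<And>j. j \<in> p k \<Longrightarrow> \<exists>a b. j = cbox a b" "pairwise (\<lambda>i j. interior i \<inter> interior j = {}) (p k)"
      using division_ofD[OF p[of k]] by (auto simp: pairwise_def)
    show "box_family (D k)" unfolding D_def by (rule box_family_of_boxes[OF *])
    show "volume (\<Union>(D k)) = volume (\<Union>(C ` {..k}))"
      using box_family_of_boxes(2)[OF *] division_ofD(6)[OF p[of k]] by (simp only: D_def)
  qed
  have sub: "\<Union>(D k) \<subseteq> K" for k
  proof -
    have "\<Union>(D k) \<subseteq> \<Union>(p k)" by (auto simp: D_def)
    also have "\<dots> \<subseteq> interior K" using division_ofD(6)[OF p[of k]] C \<D>'(3) by auto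
    finally show ?thesis using interior_subset by blast
  qed
  have "\<Union>(C ` {..k}) \<in> lmeasurable" for k
    using C \<D>'(4) by (intro fmeasurable.finite_UN) (auto, metis lmeasurable_cbox)
  moreover have "(\<Union>k. \<Union>(C ` {..k})) = interior K" using C_range \<D>'(3) by auto
  moreover have "interior K \<in> lmeasurable" using K(2) by (simp add: compact_imp_bounded lmeasurable_interior)
  ultimately have "(\<lambda>k. volume (\<Union>(C ` {..k}))) \<longlonglongrightarrow> volume (interior K)"
    using Lim_measure_incseq[of "\<lambda>k. \<Union>(C ` {..k})" lebesgue]
    by (force simp: fmeasurable_def incseq_def)
  moreover have "volume (interior K) = volume K"
  proof (rule measure_negligible_symdiff[OF lmeasurable_compact[OF K(2)]])
    have "K - interior K \<union> (interior K - K) \<subseteq> frontier K"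
      using interior_subset closure_subset by (auto simp: frontier_def)
    then show "negligible (K - interior K \<union> (interior K - K))"
      using negligible_convex_frontier[OF K(1)] negligible_subset by blast
  qed
  ultimately show ?thesis using fam sub by (intro that[of D]) auto
qed

theorem brunn_minkowski:
  fixes K L :: "'a::euclidean_space set"
  assumes K: "convex K" "compact K" "0 < volume K" and L: "convex L" "compact L" "0 < volume L"
  shows "root DIM('a) (volume K) + root DIM('a) (volume L) \<le> root DIM('a) (volume (K + L))"
proof -
  obtain D where D: "\<And>k::nat. box_family (D k)" "\<And>k. \<Union>(D k) \<subseteq> K" "(\<lambda>k. volume (\<Union>(D k))) \<longlonglongrightarrow> volume K"
    by (rule inner_box_families[OF K(1,2)]) (rule that)
  obtain E where E: "\<And>k::nat. box_family (E k)" "\<And>k. \<Union>(E k) \<subseteq> L" "(\<lambda>k. volume (\<Union>(E k))) \<longlonglongrightarrow> volume L"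
    by (rule inner_box_families[OF L(1,2)]) (rule that)
  have "\<forall>\<^sub>F k in sequentially. 0 < volume (\<Union>(D k))" "\<forall>\<^sub>F k in sequentially. 0 < volume (\<Union>(E k))"
    using order_tendstoD(1)[OF D(3)] order_tendstoD(1)[OF E(3)] K(3) L(3) by auto
  then have "\<forall>\<^sub>F k in sequentially.
      (root DIM('a) (volume (\<Union>(D k))) + root DIM('a) (volume (\<Union>(E k)))) ^ DIM('a) \<le> volume (K + L)"
  proof eventually_elim
    case (elim k)
    then have "D k \<noteq> {}" "E k \<noteq> {}" by auto
    then have "(root DIM('a) (volume (\<Union>(D k))) + root DIM('a) (volume (\<Union>(E k)))) ^ DIM('a) \<le> volume (\<Union>(D k) + \<Union>(E k))"
      using brunn_minkowski_boxes D(1) E(1) by blast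
    also have "\<dots> \<le> volume (K + L)"
      using D(1,2) E(1,2) K(2) L(2)
      by (intro measure_mono_fmeasurable set_plus_mono2)
        (auto intro!: lmeasurable_compact compact_set_plus fmeasurableD box_family_compact)
    finally show ?case .
  qed
  moreover have "(\<lambda>k. (root DIM('a) (volume (\<Union>(D k))) + root DIM('a) (volume (\<Union>(E k)))) ^ DIM('a))
      \<longlonglongrightarrow> (root DIM('a) (volume K) + root DIM('a) (volume L)) ^ DIM('a)"
    using D(3) E(3) by (intro tendsto_intros)
  ultimately have "(root DIM('a) (volume K) + root DIM('a) (volume L)) ^ DIM('a) \<le> volume (K + L)"
    by (intro tendsto_upperbound) auto
  then have "root DIM('a) ((root DIM('a) (volume K) + root DIM('a) (volume L)) ^ DIM('a)) \<le> root DIM('a) (volume (K + L))"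
    by simp
  then show ?thesis by (subst (asm) real_root_power_cancel) auto
qed

lemma volume_scaleR: "volume ((*\<^sub>R) c ` (K :: 'a::euclidean_space set)) = \<bar>c\<bar> ^ DIM('a) * volume K"
  using measure_lebesgue_affine[of c 0 K] by simp

lemma root_volume_sum_ge:
  fixes K :: "nat \<Rightarrow> 'a::euclidean_space set"
  assumes K: "\<And>k. K k \<in> conv_bodies" "\<And>k. volume (K k) = v" and v: "0 < v" and w: "\<And>k. 0 < w k"
  shows "(\<Sum>k\<le>N. w k) * root DIM('a) v \<le> root DIM('a) (volume (\<Sum>k\<le>N. (*\<^sub>R) (w k) ` K k))"
proof (induction N)
  case 0
  show ?case using K w v by (simp add: volume_scaleR real_root_mult real_root_power_cancel)
next
  case (Suc N)
  let ?S = "\<Sum>k\<le>N. (*\<^sub>R) (w k) ` K k" and ?T = "(*\<^sub>R) (w (Suc N)) ` K (Suc N)"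
  have ST: "?S \<in> conv_bodies" "?T \<in> conv_bodies" using K by (auto intro!: conv_bodies_sum conv_bodies_scaleR)
  have T: "volume ?T = w (Suc N) ^ DIM('a) * v" using w[of "Suc N"] K by (simp add: volume_scaleR)
  then have "0 < volume ?T" using w v by simp
  have "0 < (\<Sum>k\<le>N. w k) * root DIM('a) v" using w v by (intro mult_pos_pos sum_pos) auto
  then have "0 < root DIM('a) (volume ?S)" using Suc.IH by linarith
  then have "0 < volume ?S" by simp
  have "root DIM('a) (volume ?T) = w (Suc N) * root DIM('a) v"
    using w[of "Suc N"] T by (simp add: real_root_mult real_root_power_cancel)
  then have "(\<Sum>k\<le>Suc N. w k) * root DIM('a) v \<le> root DIM('a) (volume ?S) + root DIM('a) (volume ?T)"
    using Suc.IH by (simp add: distrib_right)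
  also have "\<dots> \<le> root DIM('a) (volume (?S + ?T))"
    using ST \<open>0 < volume ?S\<close> \<open>0 < volume ?T\<close> by (intro brunn_minkowski) (auto dest: conv_bodiesD)
  finally show ?case by simp
qed

section \<open>Support functions and the Hukuhara derivative\<close>

definition support_fun :: "'a::euclidean_space set \<Rightarrow> 'a \<Rightarrow> real" where
  "support_fun K u = (SUP x\<in>K. x \<bullet> u)"

lemma support_fun_attained:
  assumes "K \<in> conv_bodies"
  obtains x where "x \<in> K" "x \<bullet> u = support_fun K u" "\<And>y. y \<in> K \<Longrightarrow> y \<bullet> u \<le> support_fun K u"
proof -
  have "continuous_on K (\<lambda>x. x \<bullet> u)" by (intro continuous_intros)
  then obtain x where x: "x \<in> K" "\<And>y. y \<in> K \<Longrightarrow> y \<bullet> u \<le> x \<bullet> u"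
    using continuous_attains_sup conv_bodiesD[OF assms] by metis
  then have "support_fun K u = x \<bullet> u"
    unfolding support_fun_def by (intro cSup_eq_maximum) auto
  then show ?thesis using x that by metis
qed

lemma support_fun_upper: "K \<in> conv_bodies \<Longrightarrow> x \<in> K \<Longrightarrow> x \<bullet> u \<le> support_fun K u"
  by (rule support_fun_attained[of K u])

lemma support_fun_eqI: "x \<in> K \<Longrightarrow> (\<And>y. y \<in> K \<Longrightarrow> y \<bullet> u \<le> x \<bullet> u) \<Longrightarrow> support_fun K u = x \<bullet> u"
  unfolding support_fun_def by (rule cSup_eq_maximum) auto

lemma support_fun_plus:
  assumes "K \<in> conv_bodies" "L \<in> conv_bodies"
  shows "support_fun (K + L) u = support_fun K u + support_fun L u"
proof -
  obtain x where x: "x \<in> K" "x \<bullet> u = support_fun K u" "\<And>y. y \<in> K \<Longrightarrow> y \<bullet> u \<le> support_fun K u"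
    by (rule support_fun_attained[OF assms(1)]) (rule that)
  obtain y where y: "y \<in> L" "y \<bullet> u = support_fun L u" "\<And>x. x \<in> L \<Longrightarrow> x \<bullet> u \<le> support_fun L u"
    by (rule support_fun_attained[OF assms(2)]) (rule that)
  have "support_fun (K + L) u = (x + y) \<bullet> u"
  proof (rule support_fun_eqI)
    show "x + y \<in> K + L" using x(1) y(1) by (rule set_plus_intro)
    fix z assume "z \<in> K + L"
    then obtain a b where "z = a + b" "a \<in> K" "b \<in> L" by (rule set_plus_elim)
    then show "z \<bullet> u \<le> (x + y) \<bullet> u"
      using x(3)[of a] y(3)[of b] by (simp add: inner_add_left x(2) y(2))
  qed
  then show ?thesis by (simp add: inner_add_left x(2) y(2))
qed

lemma support_fun_singleton: "support_fun {x} u = x \<bullet> u"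
  by (rule support_fun_eqI) auto

lemma support_fun_sum:
  assumes "\<And>i. i \<in> I \<Longrightarrow> K i \<in> conv_bodies"
  shows "support_fun (\<Sum>i\<in>I. K i) u = (\<Sum>i\<in>I. support_fun (K i) u)"
  using assms
  by (induction I rule: infinite_finite_induct)
     (simp_all add: support_fun_singleton support_fun_plus conv_bodies_sum)

lemma support_fun_scaleR:
  assumes "K \<in> conv_bodies" "0 \<le> c"
  shows "support_fun ((*\<^sub>R) c ` K) u = c * support_fun K u"
proof -
  obtain x where x: "x \<in> K" "x \<bullet> u = support_fun K u" "\<And>y. y \<in> K \<Longrightarrow> y \<bullet> u \<le> support_fun K u"
    by (rule support_fun_attained[OF assms(1)]) (rule that)
  have "support_fun ((*\<^sub>R) c ` K) u = (c *\<^sub>R x) \<bullet> u"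
    using x assms(2) by (intro support_fun_eqI) (auto intro!: mult_left_mono)
  then show ?thesis using x(2) by simp
qed

lemma support_fun_image:
  assumes "K \<in> conv_bodies" "\<And>x. f x \<bullet> u = x \<bullet> v"
  shows "support_fun (f ` K) u = support_fun K v"
proof -
  obtain x where x: "x \<in> K" "x \<bullet> v = support_fun K v" "\<And>y. y \<in> K \<Longrightarrow> y \<bullet> v \<le> support_fun K v"
    by (rule support_fun_attained[OF assms(1)]) (rule that)
  have "support_fun (f ` K) u = f x \<bullet> u"
    using x assms(2) by (intro support_fun_eqI) auto
  then show ?thesis using x(2) assms(2) by simp
qed

lemma subset_plus_cball_if_support_fun_le:
  assumes K: "K \<in> conv_bodies" and L: "L \<in> conv_bodies" and "0 \<le> e"
    and le: "\<And>u. norm u = 1 \<Longrightarrow> support_fun K u \<le> support_fun L u + e"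
  shows "K \<subseteq> L + cball 0 e"
proof (rule subsetI, rule ccontr)
  fix x assume "x \<in> K" "x \<notin> L + cball 0 e"
  let ?S = "L + cball 0 e"
  have "convex ?S" "closed ?S"
    using L by (auto intro!: convex_set_plus compact_imp_closed compact_set_plus dest: conv_bodiesD)
  then obtain a b where ab: "a \<bullet> x < b" "\<And>y. y \<in> ?S \<Longrightarrow> b < a \<bullet> y"
    using separating_hyperplane_closed_point[of ?S x] \<open>x \<notin> ?S\<close> by blast
  obtain y0 where y0: "y0 \<in> L" using conv_bodiesD(1)[OF L] by blast
  have "y0 + 0 \<in> ?S" using y0 \<open>0 \<le> e\<close> by (intro set_plus_intro) auto
  then have "a \<noteq> 0" using ab by force
  define u where "u = - (1 / norm a) *\<^sub>R a"
  have u: "norm u = 1" using \<open>a \<noteq> 0\<close> by (simp add: u_def)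
  obtain y where y: "y \<in> L" "y \<bullet> u = support_fun L u"
    by (rule support_fun_attained[OF L]) (rule that)
  have "y + e *\<^sub>R u \<in> ?S" using y u \<open>0 \<le> e\<close> by (intro set_plus_intro) auto
  then have "a \<bullet> x < a \<bullet> (y + e *\<^sub>R u)" using ab by force
  then have "(y + e *\<^sub>R u) \<bullet> u < x \<bullet> u"
    using \<open>a \<noteq> 0\<close> by (simp add: u_def inner_commute field_simps)
  moreover have "(y + e *\<^sub>R u) \<bullet> u = support_fun L u + e"
    using u y by (simp add: inner_add_left dot_square_norm)
  ultimately show False using le[OF u] support_fun_upper[OF K \<open>x \<in> K\<close>, of u] by linarith
qed

lemma support_fun_inject:
  assumes "K \<in> conv_bodies" "L \<in> conv_bodies" "\<And>u. support_fun K u = support_fun L u"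
  shows "K = L"
proof -
  have "K \<subseteq> L + cball 0 0" "L \<subseteq> K + cball 0 0"
    using assms by (intro subset_plus_cball_if_support_fun_le; simp)+
  then show ?thesis by (simp flip: set_zero)
qed

lemma hukuhara_diff_eq:
  assumes "is_hukuhara_diff X Y Z" "Y \<in> conv_bodies"
  shows "hukuhara_diff X Y = Z"
  unfolding hukuhara_diff_def
proof (rule the_equality)
  show "is_hukuhara_diff X Y Z" by (rule assms(1))
  fix Z' assume Z': "is_hukuhara_diff X Y Z'"
  have Z: "Z \<in> conv_bodies" "X = Y + Z" "Z' \<in> conv_bodies" "X = Y + Z'"
    using assms(1) Z' by (simp_all add: is_hukuhara_diff_def)
  have "support_fun Z' u = support_fun Z u" for u
    using support_fun_plus[OF assms(2) Z(1), of u] support_fun_plus[OF assms(2) Z(3), of u]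
    unfolding Z(2)[symmetric] Z(4)[symmetric] by linarith
  then show "Z' = Z" by (rule support_fun_inject[OF Z(3,1)])
qed

lemma support_fun_le_hausdorff:
  assumes X: "X \<in> conv_bodies" and Y: "Y \<in> conv_bodies"
  shows "support_fun X u \<le> support_fun Y u + (SUP x\<in>X. infdist x Y) * norm u"
proof -
  obtain x where x: "x \<in> X" "x \<bullet> u = support_fun X u"
    by (rule support_fun_attained[OF X]) (rule that)
  obtain y where y: "y \<in> Y" "infdist x Y = dist x y"
    using infdist_attains_inf[of Y x] conv_bodiesD[OF Y] by (metis compact_imp_closed)
  have "compact ((\<lambda>x. infdist x Y) ` X)"
    using conv_bodiesD(3)[OF X] by (intro compact_continuous_image continuous_intros)
  then have "dist x y \<le> (SUP x\<in>X. infdist x Y)"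
    unfolding y(2)[symmetric] using x(1)
    by (intro cSUP_upper bounded_imp_bdd_above compact_imp_bounded) auto
  then have "dist x y * norm u \<le> (SUP x\<in>X. infdist x Y) * norm u"
    by (rule mult_right_mono) simp
  moreover have "(x - y) \<bullet> u \<le> dist x y * norm u"
    unfolding dist_norm by (rule norm_cauchy_schwarz)
  moreover have "y \<bullet> u \<le> support_fun Y u" by (rule support_fun_upper[OF Y y(1)])
  ultimately show ?thesis using x(2) by (simp add: inner_diff_left)
qed

lemma abs_support_fun_diff_le:
  assumes X: "X \<in> conv_bodies" and Y: "Y \<in> conv_bodies"
  shows "\<bar>support_fun X u - support_fun Y u\<bar> \<le> hausdorff_dist X Y * norm u"
proof -
  have "(SUP x\<in>X. infdist x Y) * norm u \<le> hausdorff_dist X Y * norm u"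
       "(SUP x\<in>Y. infdist x X) * norm u \<le> hausdorff_dist X Y * norm u"
    unfolding hausdorff_dist_def by (rule mult_right_mono; simp)+
  then show ?thesis
    using support_fun_le_hausdorff[OF X Y, of u] support_fun_le_hausdorff[OF Y X, of u] by linarith
qed

lemma tendsto_support_fun_hukuhara_quotient:
  fixes U V :: "real \<Rightarrow> 'a::euclidean_space set"
  assumes D: "D \<in> conv_bodies" and V: "\<forall>\<^sub>F h in at_right 0. V h \<in> conv_bodies"
    and ex: "\<forall>\<^sub>F h in at_right 0. \<exists>Z. is_hukuhara_diff (U h) (V h) Z"
    and lim: "((\<lambda>h. hausdorff_dist ((*\<^sub>R) (inverse h) ` hukuhara_diff (U h) (V h)) D) \<longlongrightarrow> 0) (at_right 0)"
  shows "((\<lambda>h. (support_fun (U h) u - support_fun (V h) u) / h) \<longlongrightarrow> support_fun D u) (at_right 0)"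
proof -
  have "((\<lambda>h. (support_fun (U h) u - support_fun (V h) u) / h - support_fun D u) \<longlongrightarrow> 0) (at_right 0)"
  proof (rule Lim_null_comparison)
    show "((\<lambda>h. hausdorff_dist ((*\<^sub>R) (inverse h) ` hukuhara_diff (U h) (V h)) D * norm u) \<longlongrightarrow> 0) (at_right 0)"
      using tendsto_mult_right[OF lim, of "norm u"] by simp
    show "\<forall>\<^sub>F h in at_right 0. norm ((support_fun (U h) u - support_fun (V h) u) / h - support_fun D u)
        \<le> hausdorff_dist ((*\<^sub>R) (inverse h) ` hukuhara_diff (U h) (V h)) D * norm u"
      using V ex eventually_at_right_less[of "0::real"]
    proof eventually_elim
      case (elim h)
      then obtain Z where Z: "is_hukuhara_diff (U h) (V h) Z" by blast
      then have ZU: "Z \<in> conv_bodies" "U h = V h + Z" by (auto simp: is_hukuhara_diff_def)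
      have "(support_fun (U h) u - support_fun (V h) u) / h = support_fun ((*\<^sub>R) (inverse h) ` Z) u"
        using elim ZU by (simp add: support_fun_plus support_fun_scaleR divide_inverse mult.commute)
      then show ?case
        using abs_support_fun_diff_le[OF conv_bodies_scaleR[OF ZU(1)] D] hukuhara_diff_eq[OF Z elim(1)] by simp
    qed
  qed
  then show ?thesis by (rule LIM_zero_cancel)
qed

lemma has_real_derivative_support_fun:
  fixes X :: "real \<Rightarrow> 'a::euclidean_space set"
  assumes X: "\<And>s. 0 \<le> s \<Longrightarrow> X s \<in> conv_bodies" and t: "0 \<le> t"
    and der: "has_hukuhara_derivative X D t"
  shows "((\<lambda>s. support_fun (X s) u) has_real_derivative support_fun D u) (at t within {0..})"
proof -
  let ?q = "\<lambda>s. (support_fun (X s) u - support_fun (X t) u) / (s - t)"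
  note d = der[unfolded has_hukuhara_derivative_def]
  have "((\<lambda>h. (support_fun (X (t + h)) u - support_fun (X t) u) / h) \<longlongrightarrow> support_fun D u) (at_right 0)"
    using d X[OF t] by (intro tendsto_support_fun_hukuhara_quotient) simp_all
  then have right: "(?q \<longlongrightarrow> support_fun D u) (at_right t)"
    by (subst filterlim_at_right_to_0) (simp add: add.commute)
  have "(?q \<longlongrightarrow> support_fun D u) (at t within {0..})"
  proof (cases "t = 0")
    case True
    then show ?thesis using right by (simp add: at_within_Ici_at_right)
  next
    case False
    then have "0 < t" using t by simp
    have "\<forall>\<^sub>F h in at_right 0. h < t" using \<open>0 < t\<close> by (rule eventually_at_right_real[THEN eventually_mono]) simp
    then have "\<forall>\<^sub>F h in at_right 0. X (t - h) \<in> conv_bodies" by eventually_elim (simp add: X)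
    then have "((\<lambda>h. (support_fun (X t) u - support_fun (X (t - h)) u) / h) \<longlongrightarrow> support_fun D u) (at_right 0)"
      using d \<open>0 < t\<close> by (intro tendsto_support_fun_hukuhara_quotient) simp_all
    moreover have "(support_fun (X t) u - support_fun (X (t - h)) u) / h = ?q (- (h + - t))" for h
    proof -
      have "- (h + - t) = t - h" "(t - h) - t = - h" by simp_all
      then show ?thesis
        using minus_divide_divide[of "support_fun (X t) u - support_fun (X (t - h)) u" h]
        by (simp only: minus_diff_eq)
    qed
    ultimately have "(?q \<longlongrightarrow> support_fun D u) (at_left t)"
      by (subst filterlim_at_left_to_right, subst filterlim_at_right_to_0) simp
    then have "(?q \<longlongrightarrow> support_fun D u) (at t)" using right by (rule filterlim_split_at)
    then show ?thesis by (rule tendsto_within_subset) simp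
  qed
  then show ?thesis by (simp add: has_field_derivative_iff)
qed

lemma bounded_on_interval:
  fixes X :: "real \<Rightarrow> 'a::euclidean_space set"
  assumes X: "\<And>s. 0 \<le> s \<Longrightarrow> X s \<in> conv_bodies"
    and cont: "\<And>u. continuous_on {0..} (\<lambda>s. support_fun (X s) u)"
  obtains B where "0 \<le> B" "\<And>s x. s \<in> {0..t} \<Longrightarrow> x \<in> X s \<Longrightarrow> norm x \<le> B"
proof -
  have "\<exists>M. \<forall>s\<in>{0..t}. support_fun (X s) u \<le> M" for u
  proof -
    have "compact ((\<lambda>s. support_fun (X s) u) ` {0..t})"
      by (intro compact_continuous_image continuous_on_subset[OF cont]) auto
    then have "bdd_above ((\<lambda>s. support_fun (X s) u) ` {0..t})"
      by (intro bounded_imp_bdd_above compact_imp_bounded)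
    then show ?thesis by (auto simp: bdd_above_def)
  qed
  then obtain M where M: "\<And>u s. s \<in> {0..t} \<Longrightarrow> support_fun (X s) u \<le> M u" by metis
  define B where "B = (\<Sum>b\<in>Basis. max 0 (max (M b) (M (- b))))"
  show ?thesis
  proof (rule that)
    show "0 \<le> B" unfolding B_def by (intro sum_nonneg) simp
    fix s x assume s: "s \<in> {0..t}" and x: "x \<in> X s"
    have le: "x \<bullet> u \<le> M u" for u
      using support_fun_upper[OF X x, of u] M[OF s, of u] s by simp
    have "\<bar>x \<bullet> b\<bar> \<le> max 0 (max (M b) (M (- b)))" for b
    proof -
      have "x \<bullet> b \<le> M b" "- (x \<bullet> b) \<le> M (- b)" using le[of b] le[of "- b"] by simp_all
      then show ?thesis by (auto simp: abs_le_iff le_max_iff_disj)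
    qed
    then show "norm x \<le> B"
      unfolding B_def by (intro order_trans[OF norm_le_l1] sum_mono)
  qed
qed

lemma inner_orthogonal_inv:
  fixes A :: "'a::euclidean_space \<Rightarrow> 'a"
  assumes "orthogonal_transformation A"
  shows "A x \<bullet> u = x \<bullet> inv A u"
  using assms orthogonal_transformation_surj[OF assms]
  by (metis orthogonal_transformation_def surj_f_inv_f)

lemma support_fun_taylor:
  fixes X :: "real \<Rightarrow> 'a::euclidean_space set"
  assumes A: "orthogonal_transformation A" and X: "solves_hukuhara_cauchy A X0 X" and t: "0 \<le> t"
  obtains B where "0 \<le> B" "\<And>N u. norm u = 1 \<Longrightarrow>
    \<bar>support_fun (X t) u - support_fun (\<Sum>k\<le>N. (*\<^sub>R) (t ^ k / fact k) ` (A ^^ k) ` X0) u\<bar> \<le> B * t ^ Suc N / fact N"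
proof -
  have body: "X s \<in> conv_bodies" and der: "has_hukuhara_derivative X (A ` X s) s" if "0 \<le> s" for s
    using X that by (auto simp: solves_hukuhara_cauchy_def)
  have X0: "X 0 = X0" "X0 \<in> conv_bodies" using X body[of 0] by (auto simp: solves_hukuhara_cauchy_def)
  note lin = orthogonal_transformation_linear[OF orthogonal_transformation_funpow[OF A]]
  have der_supp: "((\<lambda>s. support_fun (X s) u) has_real_derivative support_fun (X s) (inv A u)) (at s within {0..})"
    if "0 \<le> s" for s u
    using has_real_derivative_support_fun[OF body that der[OF that], of u]
      support_fun_image[OF body[OF that] inner_orthogonal_inv[OF A]] by simp
  then have "continuous_on {0..} (\<lambda>s. support_fun (X s) u)" for u
    by (intro DERIV_continuous_on) auto
  then obtain B where B: "0 \<le> B" "\<And>s x. s \<in> {0..t} \<Longrightarrow> x \<in> X s \<Longrightarrow> norm x \<le> B"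
    using bounded_on_interval[where X = X and t = t] body by metis
  have norm_inv: "norm ((inv A ^^ k) u) = norm u" for k u
  proof (induction k)
    case (Suc k)
    have "norm (inv A v) = norm v" for v
      using orthogonal_transformation_norm[OF A, of "inv A v"] orthogonal_transformation_surj[OF A]
      by (simp add: surj_f_inv_f)
    then show ?case using Suc by simp
  qed simp
  have pow_inner: "(A ^^ k) x \<bullet> u = x \<bullet> (inv A ^^ k) u" for k x u
  proof (induction k arbitrary: u)
    case (Suc k)
    have "(A ^^ Suc k) x \<bullet> u = (A ^^ k) x \<bullet> inv A u" by (simp add: inner_orthogonal_inv[OF A])
    also have "\<dots> = x \<bullet> (inv A ^^ Suc k) u" by (simp only: Suc.IH funpow_Suc_right o_apply)
    finally show ?case .
  qed simp
  show ?thesis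
  proof (rule that[OF B(1)])
    fix N and u :: 'a assume u: "norm u = 1"
    let ?f = "\<lambda>k s. support_fun (X s) ((inv A ^^ k) u)"
    have "norm (?f 0 t - (\<Sum>k\<le>N. ?f k 0 * (t - 0) ^ k / fact k)) \<le> B * norm (t - 0) ^ Suc N / fact N"
    proof (rule field_Taylor[where S = "{0..t}"])
      fix k s assume "s \<in> {0..t}"
      then have "((\<lambda>s. support_fun (X s) ((inv A ^^ k) u)) has_real_derivative
          support_fun (X s) (inv A ((inv A ^^ k) u))) (at s within {0..t})"
        by (intro DERIV_subset[OF der_supp]) auto
      then show "(?f k has_real_derivative ?f (Suc k) s) (at s within {0..t})" by simp
    next
      fix s assume s: "s \<in> {0..t}"
      obtain x where x: "x \<in> X s" "x \<bullet> (inv A ^^ Suc N) u = ?f (Suc N) s"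
        by (rule support_fun_attained[OF body]) (use s that in auto)
      have "norm (?f (Suc N) s) \<le> norm x * norm ((inv A ^^ Suc N) u)"
        using Cauchy_Schwarz_ineq2[of x "(inv A ^^ Suc N) u"] by (simp only: x(2) real_norm_def)
      then show "norm (?f (Suc N) s) \<le> B"
        unfolding norm_inv u using B(2)[OF s x(1)] by simp
    qed (use t in auto)
    moreover have "support_fun (\<Sum>k\<le>N. (*\<^sub>R) (t ^ k / fact k) ` (A ^^ k) ` X0) u = (\<Sum>k\<le>N. ?f k 0 * t ^ k / fact k)"
      using X0 t lin
      by (simp add: support_fun_sum support_fun_scaleR conv_bodies_scaleR conv_bodies_linear_image
          support_fun_image[OF _ pow_inner] mult.commute)
    ultimately show "\<bar>support_fun (X t) u - support_fun (\<Sum>k\<le>N. (*\<^sub>R) (t ^ k / fact k) ` (A ^^ k) ` X0) u\<bar>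
        \<le> B * t ^ Suc N / fact N" using t by simp
  qed
qed

section \<open>Volume of the solution\<close>

lemma volume_plus_cball_le:
  fixes K :: "'a::euclidean_space set"
  assumes K: "K \<in> conv_bodies" and r: "0 < r" "cball c r \<subseteq> K" and e: "0 \<le> e"
  shows "volume (K + cball 0 e) \<le> (1 + e / r) ^ DIM('a) * volume K"
proof -
  let ?T = "\<lambda>x. (1 + e / r) *\<^sub>R x + (- (e / r)) *\<^sub>R c"
  have s: "0 < 1 + e / r" using r e by (simp add: add_pos_nonneg)
  have "K + cball 0 e \<subseteq> ?T ` K"
  proof
    fix x assume "x \<in> K + cball 0 e"
    then obtain k d where kd: "x = k + d" "k \<in> K" "d \<in> cball 0 e" by (rule set_plus_elim)
    obtain p where p: "p \<in> K" "(e / r) *\<^sub>R (p - c) = d"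
    proof (cases "e = 0")
      case True
      then show ?thesis using kd that[of k] by simp
    next
      case False
      have "norm ((r / e) *\<^sub>R d) \<le> r" using kd(3) r e False by (simp add: field_simps mult_left_mono)
      then have "c + (r / e) *\<^sub>R d \<in> K" by (intro subsetD[OF r(2)]) (simp add: dist_norm)
      then show ?thesis using r e False by (intro that[of "c + (r / e) *\<^sub>R d"]) simp_all
    qed
    define q where "q = (1 / (1 + e / r)) *\<^sub>R k + ((e / r) / (1 + e / r)) *\<^sub>R p"
    have "1 / (1 + e / r) + (e / r) / (1 + e / r) = 1"
      unfolding add_divide_distrib[symmetric] using s by simp
    then have "q \<in> K" unfolding q_def
      using kd(2) p(1) s r e by (intro convexD[OF conv_bodiesD(2)[OF K]]) simp_all
    moreover have "x = ?T q"
      using s by (simp add: q_def scaleR_add_right kd(1) p(2)[symmetric] scaleR_diff_right)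
    ultimately show "x \<in> ?T ` K" by blast
  qed
  moreover have "compact (?T ` K)"
    using conv_bodiesD(3)[OF K] by (intro compact_continuous_image continuous_intros)
  moreover have "compact (K + cball 0 e)" using conv_bodiesD(3)[OF K] by (intro compact_set_plus) auto
  ultimately have "volume (K + cball 0 e) \<le> volume (?T ` K)"
    by (intro measure_mono_fmeasurable lmeasurable_compact) (auto dest: lmeasurable_compact fmeasurableD)
  also have "\<dots> = \<bar>1 + e / r\<bar> ^ DIM('a) * volume K" by (rule measure_lebesgue_affine)
  finally show ?thesis using s by simp
qed

lemma volume_ge_if_parallel_bodies_ge:
  fixes K :: "'a::euclidean_space set"
  assumes K: "compact K" and v: "\<And>e. 0 < e \<Longrightarrow> v \<le> volume (K + cball 0 e)"
  shows "v \<le> volume K"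
proof -
  let ?K = "\<lambda>k. K + cball 0 (1 / real (Suc k))"
  have comp: "compact (?K k)" for k using K by (intro compact_set_plus) auto
  have "(\<Inter>k. ?K k) = K"
  proof (intro subset_antisym subsetI)
    fix x assume x: "x \<in> (\<Inter>k. ?K k)"
    have "\<exists>y\<in>K. dist y x < d" if d: "0 < d" for d
    proof -
      obtain k where k: "1 / real (Suc k) < d" using nat_approx_posE[OF d] by metis
      obtain y z where "x = y + z" "y \<in> K" "z \<in> cball 0 (1 / real (Suc k))"
        using x by (meson INT_D UNIV_I set_plus_elim)
      then show ?thesis using k by (intro bexI[of _ y]) (auto simp: dist_norm)
    qed
    then have "x \<in> closure K" unfolding closure_approachable by blast
    then show "x \<in> K" using K by (simp add: compact_imp_closed closure_closed)
  next
    fix x assume "x \<in> K"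
    then have "x + 0 \<in> ?K k" for k by (intro set_plus_intro) auto
    then show "x \<in> (\<Inter>k. ?K k)" by simp
  qed
  moreover have "decseq ?K"
  proof (rule decseq_SucI)
    fix k
    have "1 / real (Suc (Suc k)) \<le> 1 / real (Suc k)" by (intro divide_left_mono) auto
    then show "?K (Suc k) \<subseteq> ?K k" by (intro set_plus_mono2 order_refl) (auto simp: subset_cball)
  qed
  then have "(\<lambda>k. volume (?K k)) \<longlonglongrightarrow> volume (\<Inter>k. ?K k)"
  proof (rule Lim_measure_decseq[rotated])
    show "range ?K \<subseteq> sets lebesgue" using fmeasurableD[OF lmeasurable_compact[OF comp]] by blast
    show "emeasure lebesgue (?K k) \<noteq> \<infinity>" for k using fmeasurableD2[OF lmeasurable_compact[OF comp]] by simp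
  qed
  ultimately have "(\<lambda>k. volume (?K k)) \<longlonglongrightarrow> volume K" by simp
  then show ?thesis by (rule LIMSEQ_le_const) (auto intro!: v)
qed

lemma tendsto_exp_partial_sums: "(\<lambda>N. \<Sum>k\<le>N. t ^ k / fact k) \<longlonglongrightarrow> exp (t::real)"
proof -
  have "(\<lambda>k. t ^ k / fact k) sums exp t"
    using exp_converges[of t] by (simp add: divide_inverse mult.commute)
  then show ?thesis by (simp add: sums_def_le)
qed

lemma solution_approximation:
  fixes X :: "real \<Rightarrow> 'a::euclidean_space set"
  assumes A: "orthogonal_transformation A" and X: "solves_hukuhara_cauchy A X0 X" and t: "0 \<le> t"
  defines "S \<equiv> \<lambda>N. \<Sum>k\<le>N. (*\<^sub>R) (t ^ k / fact k) ` (A ^^ k) ` X0"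
  obtains e where "e \<longlonglongrightarrow> 0" "\<And>N. 0 \<le> e N" "\<And>N. X t \<subseteq> S N + cball 0 (e N)" "\<And>N. S N \<subseteq> X t + cball 0 (e N)"
proof -
  have X0: "X0 \<in> conv_bodies" and Xt: "X t \<in> conv_bodies" using X t by (auto simp: solves_hukuhara_cauchy_def)
  note lin = orthogonal_transformation_linear[OF orthogonal_transformation_funpow[OF A]]
  have S_apply: "S N = (\<Sum>k\<le>N. (*\<^sub>R) (t ^ k / fact k) ` (A ^^ k) ` X0)" for N by (simp add: S_def)
  have S: "S N \<in> conv_bodies" for N
    unfolding S_def by (intro conv_bodies_sum conv_bodies_scaleR conv_bodies_linear_image lin X0)
  obtain B where B: "0 \<le> B" "\<And>N u. norm u = 1 \<Longrightarrow>
    \<bar>support_fun (X t) u - support_fun (S N) u\<bar> \<le> B * t ^ Suc N / fact N"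
    by (rule support_fun_taylor[OF A X t, folded S_apply]) (rule that)
  let ?e = "\<lambda>N. B * t ^ Suc N / fact N"
  show ?thesis
  proof (rule that[of ?e])
    have "(\<lambda>N. t ^ N / fact N) \<longlonglongrightarrow> 0"
      using summable_LIMSEQ_zero[OF summable_exp[of t]] by (simp add: divide_inverse mult.commute)
    from tendsto_mult_right[OF this, of "B * t"] show "?e \<longlonglongrightarrow> 0" by (simp add: mult_ac)
    show nn: "0 \<le> ?e N" for N using B(1) t by simp
    have "support_fun (X t) u \<le> support_fun (S N) u + ?e N" "support_fun (S N) u \<le> support_fun (X t) u + ?e N"
      if "norm u = 1" for N u
      using B(2)[OF that, of N] by linarith+
    then show "X t \<subseteq> S N + cball 0 (?e N)" "S N \<subseteq> X t + cball 0 (?e N)" for N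
      by (intro subset_plus_cball_if_support_fun_le S Xt nn; simp)+
  qed
qed

theorem lemma3p2:
  fixes A :: "real ^ 'n \<Rightarrow> real ^ 'n"
    and X0 :: "(real ^ 'n) set"
    and X :: "real \<Rightarrow> (real ^ 'n) set"
  assumes "orthogonal_transformation A"
    and "X0 \<in> conv_bodies"
    and "interior X0 \<noteq> {}"
    and "solves_hukuhara_cauchy A X0 X"
  shows "\<forall>t\<ge>0. volume X0 * exp (real CARD('n) * t) \<le> volume (X t) \<and>
           volume (X t) \<le> orbit_mixed_volume_sup A X0 * exp (real CARD('n) * t)"
proof (intro allI impI conjI)
  fix t :: real assume t: "0 \<le> t"
  let ?n = "CARD('n)" and ?M = "orbit_mixed_volume_sup A X0"
  define w where "w k = t ^ k / fact k" for k
  define S where "S N = (\<Sum>k\<le>N. (*\<^sub>R) (w k) ` (A ^^ k) ` X0)" for N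
  note A = assms(1) and X0 = assms(2)
  have Xt: "X t \<in> conv_bodies" using assms(4) t by (simp add: solves_hukuhara_cauchy_def)
  have orbit: "(A ^^ k) ` X0 \<in> conv_bodies" "volume ((A ^^ k) ` X0) = volume X0" for k
    using orthogonal_transformation_funpow[OF A, of k] X0
    by (auto intro: conv_bodies_linear_image volume_orthogonal_image orthogonal_transformation_linear conv_bodiesD)
  have S: "S N \<in> conv_bodies" for N
    unfolding S_def by (intro conv_bodies_sum conv_bodies_scaleR orbit)
  have w: "0 \<le> w k" for k using t by (simp add: w_def)
  have lim: "(\<lambda>N. (\<Sum>k\<le>N. w k) ^ ?n) \<longlonglongrightarrow> exp (real ?n * t)"
    using tendsto_power[OF tendsto_exp_partial_sums[of t], of ?n] by (simp add: w_def exp_of_nat_mult)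
  obtain e where e: "e \<longlonglongrightarrow> 0" "\<And>N. 0 \<le> e N" "\<And>N. X t \<subseteq> S N + cball 0 (e N)" "\<And>N. S N \<subseteq> X t + cball 0 (e N)"
    by (rule solution_approximation[OF A assms(4) t, folded w_def, folded S_def]) (rule that)
  have "\<not> negligible X0" using assms(3)
    by (meson interior_subset negligible_subset open_interior open_not_negligible)
  then have pos: "0 < volume X0"
    using conv_bodies_lmeasurable[OF X0] by (simp add: negligible_iff_measure less_le)

  show "volume X0 * exp (real ?n * t) \<le> volume (X t)"
  proof (cases "t = 0")
    case True
    then show ?thesis using assms(4) by (simp add: solves_hukuhara_cauchy_def)
  next
    case False
    then have "0 < w k" for k using t by (simp add: w_def)
    then have "(\<Sum>k\<le>N. w k) * root ?n (volume X0) \<le> root ?n (volume (S N))" for N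
      using root_volume_sum_ge[OF orbit pos, of w N] by (simp add: S_def)
    then have "((\<Sum>k\<le>N. w k) * root ?n (volume X0)) ^ ?n \<le> root ?n (volume (S N)) ^ ?n" for N
      using w pos by (intro power_mono mult_nonneg_nonneg sum_nonneg) auto
    then have vol_S: "(\<Sum>k\<le>N. w k) ^ ?n * volume X0 \<le> volume (S N)" for N
      using pos by (simp add: power_mult_distrib)
    show ?thesis
    proof (rule volume_ge_if_parallel_bodies_ge[OF conv_bodiesD(3)[OF Xt]])
      fix d :: real assume "0 < d"
      have "\<forall>\<^sub>F N in sequentially. e N < d" using order_tendstoD(2)[OF e(1) \<open>0 < d\<close>] .
      then have "\<forall>\<^sub>F N in sequentially. (\<Sum>k\<le>N. w k) ^ ?n * volume X0 \<le> volume (X t + cball 0 d)"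
      proof eventually_elim
        case (elim N)
        have "X t + cball 0 (e N) \<subseteq> X t + cball 0 d"
          using elim by (intro set_plus_mono2 order_refl) (simp add: subset_cball)
        with e(4)[of N] have "S N \<subseteq> X t + cball 0 d" by (rule order_trans)
        moreover have "compact (X t + cball 0 d)" using conv_bodiesD(3)[OF Xt] by (intro compact_set_plus) auto
        ultimately have "volume (S N) \<le> volume (X t + cball 0 d)"
          by (intro measure_mono_fmeasurable lmeasurable_compact fmeasurableD[OF conv_bodies_lmeasurable[OF S]])
        then show ?case using vol_S[of N] by linarith
      qed
      then have "exp (real ?n * t) * volume X0 \<le> volume (X t + cball 0 d)"
        using tendsto_mult_right[OF lim, of "volume X0"] by (intro tendsto_upperbound) (auto simp: mult.commute)
      then show "volume X0 * exp (real ?n * t) \<le> volume (X t + cball 0 d)" by (simp add: mult.commute)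
    qed
  qed

  have vol_S: "volume (S N) \<le> ?M * (\<Sum>k\<le>N. w k) ^ ?n" for N
    using volume_orbit_sum_le[where w = w and N = "Suc N", OF A X0 w] by (simp only: S_def lessThan_Suc_atMost)
  obtain c r where r: "0 < r" "cball c r \<subseteq> X0"
    using assms(3) by (metis ex_in_conv mem_interior_cball)
  have "\<exists>c'. cball c' r \<subseteq> S N" for N
  proof -
    have "w 0 = 1" by (simp add: w_def)
    have split: "S N = X0 + (\<Sum>k\<in>{..N} - {0}. (*\<^sub>R) (w k) ` (A ^^ k) ` X0)"
      unfolding S_def by (subst sum.remove[of _ 0]) (simp_all add: \<open>w 0 = 1\<close> image_def)
    have "(\<Sum>k\<in>{..N} - {0}. (*\<^sub>R) (w k) ` (A ^^ k) ` X0) \<in> conv_bodies"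
      by (intro conv_bodies_sum conv_bodies_scaleR orbit)
    then obtain y where y: "y \<in> (\<Sum>k\<in>{..N} - {0}. (*\<^sub>R) (w k) ` (A ^^ k) ` X0)"
      using conv_bodiesD(1) by blast
    have "cball (c + y) r \<subseteq> S N"
    proof
      fix x assume "x \<in> cball (c + y) r"
      then have "x - y \<in> X0" by (intro subsetD[OF r(2)]) (simp add: dist_norm algebra_simps)
      from set_plus_intro[OF this y] show "x \<in> S N" by (simp add: split)
    qed
    then show ?thesis by blast
  qed
  then have "volume (S N + cball 0 (e N)) \<le> (1 + e N / r) ^ ?n * volume (S N)" for N
    using volume_plus_cball_le[OF S r(1) _ e(2)] by (metis DIM_cart DIM_real mult.right_neutral)
  moreover have "volume (X t) \<le> volume (S N + cball 0 (e N))" for N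
  proof (rule measure_mono_fmeasurable[OF e(3)])
    show "X t \<in> sets lebesgue" by (rule fmeasurableD[OF conv_bodies_lmeasurable[OF Xt]])
    show "S N + cball 0 (e N) \<in> lmeasurable"
      using conv_bodiesD(3)[OF S] by (intro lmeasurable_compact compact_set_plus) auto
  qed
  moreover have "(1 + e N / r) ^ ?n * volume (S N) \<le> (1 + e N / r) ^ ?n * (?M * (\<Sum>k\<le>N. w k) ^ ?n)" for N
    using vol_S e(2)[of N] r(1) by (intro mult_left_mono) auto
  ultimately have "volume (X t) \<le> (1 + e N / r) ^ ?n * (?M * (\<Sum>k\<le>N. w k) ^ ?n)" for N
    by (meson order_trans)
  moreover have "(\<lambda>N. (1 + e N / r) ^ ?n * (?M * (\<Sum>k\<le>N. w k) ^ ?n))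
      \<longlonglongrightarrow> (1 + 0 / r) ^ ?n * (?M * exp (real ?n * t))"
    using r(1) by (intro tendsto_intros e(1) lim) auto
  ultimately show "volume (X t) \<le> ?M * exp (real ?n * t)"
    by (intro LIMSEQ_le_const[where X = "\<lambda>N. (1 + e N / r) ^ ?n * (?M * (\<Sum>k\<le>N. w k) ^ ?n)"]) auto
qed

end
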